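(* Let $X$ be a Čech-complete space, let $(M,d)$ be a metric space, and let $G\subseteq C(X,M)$ be such that $\overline{G}^{M^X}$ is compact. Consider the following three properties: (a) $G$ is hereditarily almost equicontinuous. (b) $G$ is hereditarily almost equicontinuous on $F$, for every separable and compact subset $F$ of $X$. (c) $(F,t_p(\overline{G}^{M^X}))$ is Lindel\"of, for every separable and compact subset $F$ of $X$. Then (a) and (b) are equivalent, and (c) implies (b).
   Context: $C(X,M)$ is the set of continuous functions from $X$ to $M$. A Čech-complete space is a completely regular Hausdorff space that is a $G_\delta$-subset of its Stone-Čech compactification. $\overline{G}^{M^X}$ is the closure of $G$ in the Tychonoff product $M^X$ (topology of pointwise convergence on $X$). For a set $H$ of functions from $X$ to $M$ and $F\subseteq X$, $H|_F=\{h|_F:h\in H\}$, and $(F,t_p(H))$ is the set $F$ with the weak (initial) topology generated by the functions in $H|_F$. A point $x\in X$ is an equicontinuity point of $G\subseteq C(X,M)$ if for every $\epsilon>0$ there is a neighborhood $U$ of $x$ such that $\mathrm{diam}(g(U))<\epsilon$ for all $g\in G$. $G$ is almost equicontinuous if its set of equicontinuity points is dense in $X$, and hereditarily almost equicontinuous if $G|_A$ is almost equicontinuous (as a subset of $C(A,M)$) for every nonempty closed subset $A$ of $X$. "$G$ is hereditarily almost equicontinuous on $F$" means that $G|_F\subseteq C(F,M)$ is hereditarily almost equicontinuous. *)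

theory Defs
  imports "HOL-Analysis.Analysis"
begin

section \<open>Cech-complete spaces\<close>

text \<open>
  The Stone-Cech compactification is the closure of the image of \<open>X\<close> under evaluation in the
  cube \<open>[0,1]\<^bsup>C(X,[0,1])\<^esup>\<close>. HOL functions are total, so a function on \<open>topspace X\<close> is represented
  by its extensional representative (value \<open>undefined\<close> off \<open>topspace X\<close>).
\<close>

definition unit_functions :: "'a topology \<Rightarrow> ('a \<Rightarrow> real) set" where
  "unit_functions X =
     {f \<in> extensional (topspace X). continuous_map X (top_of_set {0..1}) f}"

definition stone_cech_map :: "'a topology \<Rightarrow> 'a \<Rightarrow> ('a \<Rightarrow> real) \<Rightarrow> real" where
  "stone_cech_map X x = (\<lambda>f \<in> unit_functions X. f x)"

definition stone_cech :: "'a topology \<Rightarrow> (('a \<Rightarrow> real) \<Rightarrow> real) topology" where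
  "stone_cech X =
     (let Q = product_topology (\<lambda>_. top_of_set {0..1}) (unit_functions X)
      in subtopology Q (Q closure_of (stone_cech_map X ` topspace X)))"

definition Cech_complete_space :: "'a topology \<Rightarrow> bool" where
  "Cech_complete_space X \<longleftrightarrow>
     completely_regular_space X \<and> Hausdorff_space X \<and>
     gdelta_in (stone_cech X) (stone_cech_map X ` topspace X)"


section \<open>Function spaces\<close>

definition continuous_functions ::
    "'a topology \<Rightarrow> 'b set \<Rightarrow> ('b \<Rightarrow> 'b \<Rightarrow> real) \<Rightarrow> ('a \<Rightarrow> 'b) set" where
  "continuous_functions X M d =
     {g \<in> extensional (topspace X). continuous_map X (Metric_space.mtopology M d) g}"

definition pointwise_topology ::
    "'a topology \<Rightarrow> 'b set \<Rightarrow> ('b \<Rightarrow> 'b \<Rightarrow> real) \<Rightarrow> ('a \<Rightarrow> 'b) topology" where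
  "pointwise_topology X M d = product_topology (\<lambda>_. Metric_space.mtopology M d) (topspace X)"

definition restrict_functions :: "('a \<Rightarrow> 'b) set \<Rightarrow> 'a set \<Rightarrow> ('a \<Rightarrow> 'b) set" where
  "restrict_functions H F = (\<lambda>h. restrict h F) ` H"

text \<open>\<open>F\<close> itself is inserted so that the carrier is \<open>F\<close> even when \<open>H\<close> is empty.\<close>

definition weak_topology :: "'a set \<Rightarrow> 'b topology \<Rightarrow> ('a \<Rightarrow> 'b) set \<Rightarrow> 'a topology" where
  "weak_topology F Y H =
     topology_generated_by (insert F {h -` U \<inter> F | h U. h \<in> H \<and> openin Y U})"


section \<open>Almost equicontinuity\<close>

text \<open>
  The diameter takes values in \<open>[0,\<infinity>]\<close>, so that an unbounded set has diameter \<open>\<infinity>\<close>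
  (the real-valued library constant \<open>diameter\<close> is unspecified there).
\<close>

definition ediameter :: "('b \<Rightarrow> 'b \<Rightarrow> real) \<Rightarrow> 'b set \<Rightarrow> ennreal" where
  "ediameter d S = (SUP (x, y) \<in> S \<times> S. ennreal (d x y))"

definition equicontinuity_point ::
    "'a topology \<Rightarrow> ('b \<Rightarrow> 'b \<Rightarrow> real) \<Rightarrow> ('a \<Rightarrow> 'b) set \<Rightarrow> 'a \<Rightarrow> bool" where
  "equicontinuity_point X d G x \<longleftrightarrow>
     x \<in> topspace X \<and>
     (\<forall>\<epsilon>::real. \<epsilon> > 0 \<longrightarrow>
        (\<exists>U. openin X U \<and> x \<in> U \<and> (\<forall>g\<in>G. ediameter d (g ` U) < ennreal \<epsilon>)))"

definition almost_equicontinuous ::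
    "'a topology \<Rightarrow> ('b \<Rightarrow> 'b \<Rightarrow> real) \<Rightarrow> ('a \<Rightarrow> 'b) set \<Rightarrow> bool" where
  "almost_equicontinuous X d G \<longleftrightarrow> X closure_of {x. equicontinuity_point X d G x} = topspace X"

definition hereditarily_almost_equicontinuous ::
    "'a topology \<Rightarrow> ('b \<Rightarrow> 'b \<Rightarrow> real) \<Rightarrow> ('a \<Rightarrow> 'b) set \<Rightarrow> bool" where
  "hereditarily_almost_equicontinuous X d G \<longleftrightarrow>
     (\<forall>A. closedin X A \<and> A \<noteq> {} \<longrightarrow>
        almost_equicontinuous (subtopology X A) d (restrict_functions G A))"

end

theory Submission
  imports Defs
begin

text \<open>
  Suppose \<open>G\<close> is not almost equicontinuous on a closed set \<open>A\<close>. By the Baire property some nonempty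
  open \<open>V \<subseteq> A\<close> has the property that every nonempty open subset of \<open>V\<close> is expanded by some \<open>g \<in> G\<close> to diameter
  \<open>> 3\<epsilon>\<close>. Since \<open>G\<close> is pointwise totally bounded, the values of functions of \<open>G\<close> at finitely many points do not
  determine, up to \<open>\<epsilon>\<close>, their values on any nonempty open subset of \<open>V\<close>. This gives a Cantor scheme
  \<open>(C s)\<close> of closed sets together with pairs \<open>g s, h s \<in> G\<close> which are \<open>\<epsilon>\<close>-apart on \<open>C s\<close> but nearly equal on all
  the other sets of the same level. By Cech-completeness the scheme has a compact kernel, and a minimal
  closed \<open>F\<close> in it meeting every \<open>C s\<close> is separable.

  No point of \<open>F\<close> is an equicontinuity point, as \<open>g s\<close> or \<open>h s\<close> must oscillate between \<open>C s\<close> and its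
  sibling. Moreover, along a branch the pairs \<open>(g s, h s)\<close> cluster at a pair in the compact closure of \<open>G\<close>
  whose members agree exactly off the fibre of that branch; hence the fibres are open in the weak
  topology. There are uncountably many of them, so \<open>F\<close> is not Lindelof.
\<close>

section \<open>Cech-completeness by open covers\<close>

text \<open>Frolik's internal form of Cech-completeness, which makes the compactification dispensable.\<close>

definition cover_complete :: "'a topology \<Rightarrow> (nat \<Rightarrow> 'a set set) \<Rightarrow> bool" where
  "cover_complete X \<U> \<longleftrightarrow>
     (\<forall>n. (\<forall>U\<in>\<U> n. openin X U) \<and> \<Union>(\<U> n) = topspace X) \<and>
     (\<forall>C. (\<forall>n. closedin X (C n) \<and> C n \<noteq> {} \<and> C (Suc n) \<subseteq> C n \<and>
                (\<exists>\<V>. finite \<V> \<and> \<V> \<subseteq> \<U> n \<and> C n \<subseteq> \<Union>\<V>)) \<longrightarrow>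
          compactin X (\<Inter>n. C n) \<and> (\<Inter>n. C n) \<noteq> {})"

lemma cover_complete_open: "\<lbrakk>cover_complete X \<U>; U \<in> \<U> n\<rbrakk> \<Longrightarrow> openin X U"
  and cover_complete_cover: "cover_complete X \<U> \<Longrightarrow> \<Union>(\<U> n) = topspace X"
  by (simp_all add: cover_complete_def)

lemma cover_complete_nest:
  assumes "cover_complete X \<U>"
    and "\<And>n. closedin X (C n)" "\<And>n. C n \<noteq> {}" "\<And>n. C (Suc n) \<subseteq> C n"
    and "\<And>n. \<exists>\<V>. finite \<V> \<and> \<V> \<subseteq> \<U> n \<and> C n \<subseteq> \<Union>\<V>"
  shows "compactin X (\<Inter>n. C n)" "(\<Inter>n. C n) \<noteq> {}"
proof -
  have "\<forall>n. closedin X (C n) \<and> C n \<noteq> {} \<and> C (Suc n) \<subseteq> C n \<and>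
      (\<exists>\<V>. finite \<V> \<and> \<V> \<subseteq> \<U> n \<and> C n \<subseteq> \<Union>\<V>)"
    using assms(2-5) by (intro allI conjI)
  then show "compactin X (\<Inter>n. C n)" "(\<Inter>n. C n) \<noteq> {}"
    using assms(1) unfolding cover_complete_def by (metis (no_types))+
qed

text \<open>Allows a closed set on which almost equicontinuity fails to be treated as the whole
  space.\<close>

lemma cover_complete_subtopology:
  assumes X: "cover_complete X \<U>" and A: "closedin X A"
  shows "cover_complete (subtopology X A) (\<lambda>n. (\<inter>) A ` \<U> n)"
  unfolding cover_complete_def
proof (intro conjI allI impI ballI)
  show "openin (subtopology X A) U" if "U \<in> (\<inter>) A ` \<U> n" for n U
    using that cover_complete_open[OF X] by (auto simp: openin_subtopology_Int2)
  show "\<Union> ((\<inter>) A ` \<U> n) = topspace (subtopology X A)" for n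
    using cover_complete_cover[OF X, of n] by auto
next
  fix C
  assume C: "\<forall>n. closedin (subtopology X A) (C n) \<and> C n \<noteq> {} \<and> C (Suc n) \<subseteq> C n \<and>
    (\<exists>\<V>. finite \<V> \<and> \<V> \<subseteq> (\<inter>) A ` \<U> n \<and> C n \<subseteq> \<Union>\<V>)"
  have C_cl: "closedin (subtopology X A) (C n)" and C_ne: "C n \<noteq> {}"
    and C_dec: "C (Suc n) \<subseteq> C n" and C_cov: "\<exists>\<V>. finite \<V> \<and> \<V> \<subseteq> (\<inter>) A ` \<U> n \<and> C n \<subseteq> \<Union>\<V>" for n
    using C[rule_format, of n] by (iprover+)
  have cl: "closedin X (C n)" "C n \<subseteq> A" for n
    using C_cl[of n] A closedin_trans_full[of X A "C n"] closedin_subset[of "subtopology X A" "C n"] by auto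
  have V: "\<exists>\<V>. finite \<V> \<and> \<V> \<subseteq> \<U> n \<and> C n \<subseteq> \<Union>\<V>" for n
  proof -
    obtain \<V> where "finite \<V>" "\<V> \<subseteq> (\<inter>) A ` \<U> n" and sub: "C n \<subseteq> \<Union>\<V>"
      using C_cov[of n] by blast
    then obtain \<W> where "finite \<W>" "\<W> \<subseteq> \<U> n" "\<V> = (\<inter>) A ` \<W>"
      by (metis finite_subset_image)
    then show ?thesis using sub by (intro exI[of _ \<W>]) auto
  qed
  show "compactin (subtopology X A) (\<Inter>n. C n)"
    using cover_complete_nest(1)[OF X cl(1) C_ne C_dec V] cl(2) by (auto simp: compactin_subtopology)
  show "(\<Inter>n. C n) \<noteq> {}"
    by (rule cover_complete_nest(2)[OF X cl(1) C_ne C_dec V])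
qed

text \<open>With the image written as the intersection of open sets \<open>D n\<close>, the cover
  \<open>\<U> n\<close> collects the open sets whose images have closure in \<open>D n\<close>.
  Closing the images of a sequence \<open>C\<close> in the compact \<open>B\<close> traps their
  intersection in every \<open>D n\<close>, hence in the image of \<open>X\<close>, so compactness
  and nonemptiness pass back to \<open>X\<close>.\<close>

lemma cover_complete_embedding:
  assumes e: "embedding_map X B e" and "compact_space B" "Hausdorff_space B"
    and gd: "gdelta_in B (e ` topspace X)"
  shows "\<exists>\<U>. cover_complete X \<U>"
proof -
  obtain D where "(\<forall>n. openin B (D n)) \<and> (\<forall>n. D (Suc n) \<subseteq> D n) \<and> \<Inter>(range D) = e ` topspace X"
    using gd by (auto simp: gdelta_in_descending)
  then have opD: "openin B (D n)" and D: "\<Inter>(range D) = e ` topspace X" for n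
    by simp_all
  have reg: "regular_space B"
    using assms compact_Hausdorff_imp_regular_space by blast
  have cont: "continuous_map X B e"
    using e continuous_map_into_fulltopology homeomorphic_imp_continuous_map
    unfolding embedding_map_def by blast
  have hom: "homeomorphic_map X (subtopology B (e ` topspace X)) e"
    using e by (simp add: embedding_map_def)
  have inj: "inj_on e (topspace X)"
    using hom by (rule homeomorphic_imp_injective_map)
  define \<U> where "\<U> n = {U. openin X U \<and> B closure_of (e ` U) \<subseteq> D n}" for n
  have cov: "\<Union>(\<U> n) = topspace X" for n
  proof
    show "\<Union>(\<U> n) \<subseteq> topspace X"
      by (auto simp: \<U>_def dest: openin_subset)
    show "topspace X \<subseteq> \<Union>(\<U> n)"
    proof
      fix x assume x: "x \<in> topspace X"
      then have "e x \<in> D n" using D by blast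
      then obtain O1 K1 where O1: "openin B O1" "closedin B K1" "e x \<in> O1" "O1 \<subseteq> K1" "K1 \<subseteq> D n"
        using reg[folded neighbourhood_base_of_closedin, unfolded neighbourhood_base_of,
            rule_format, of "D n" "e x"] opD[of n] by blast
      let ?U = "{y \<in> topspace X. e y \<in> O1}"
      have "openin X ?U" using cont O1(1) by (simp add: openin_continuous_map_preimage)
      moreover have "B closure_of (e ` ?U) \<subseteq> K1"
        using O1 by (intro closure_of_minimal) auto
      ultimately show "x \<in> \<Union>(\<U> n)"
        using O1 x by (auto simp: \<U>_def)
    qed
  qed
  have "cover_complete X \<U>"
    unfolding cover_complete_def
  proof (intro conjI allI impI ballI)
    show "openin X U" if "U \<in> \<U> n" for n U
      using that by (simp add: \<U>_def)
    show "\<Union>(\<U> n) = topspace X" for n by (rule cov)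
  next
    fix C
    assume C: "\<forall>n. closedin X (C n) \<and> C n \<noteq> {} \<and> C (Suc n) \<subseteq> C n \<and>
                (\<exists>\<V>. finite \<V> \<and> \<V> \<subseteq> \<U> n \<and> C n \<subseteq> \<Union>\<V>)"
    have C_cl: "closedin X (C n)" and C_ne: "C n \<noteq> {}" and C_dec: "C (Suc n) \<subseteq> C n"
      and C_cov: "\<exists>\<V>. finite \<V> \<and> \<V> \<subseteq> \<U> n \<and> C n \<subseteq> \<Union>\<V>" for n
      using C[rule_format, of n] by (iprover+)
    have C_sub: "C n \<subseteq> topspace X" for n
      by (rule closedin_subset[OF C_cl])
    define K where "K n = B closure_of (e ` C n)" for n
    have KD: "K n \<subseteq> D n" for n
    proof -
      obtain \<V> where V: "finite \<V>" "\<V> \<subseteq> \<U> n" "C n \<subseteq> \<Union>\<V>" using C_cov[of n] by blast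
      have "K n \<subseteq> B closure_of (\<Union>U\<in>\<V>. e ` U)"
        unfolding K_def using V(3) by (intro closure_of_mono) blast
      also have "\<dots> = (\<Union>U\<in>\<V>. B closure_of (e ` U))"
        using V(1) by (simp add: closure_of_Union image_image)
      also have "\<dots> \<subseteq> D n" using V(2) by (auto simp: \<U>_def)
      finally show ?thesis .
    qed
    \<comment> \<open>Since \<open>C n\<close> is closed in \<open>X\<close>, taking the closure in
      \<open>B\<close> adds no point of the image of \<open>X\<close>.\<close>
    have KC: "K n \<inter> e ` topspace X = e ` C n" for n
    proof -
      have "closedin (subtopology B (e ` topspace X)) (e ` C n)"
        using homeomorphic_map_closedness_eq[OF hom] C_cl C_sub by blast
      then have "subtopology B (e ` topspace X) closure_of (e ` C n) = e ` C n"
        by (simp add: closure_of_closedin)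
      moreover have "e ` C n \<subseteq> e ` topspace X"
        using C_sub by blast
      ultimately show ?thesis
        unfolding K_def by (simp add: closure_of_subtopology Int_absorb1 Int_commute)
    qed
    have eq: "(\<Inter>n. K n) = e ` (\<Inter>n. C n)"
    proof -
      have "(\<Inter>n. K n) \<subseteq> \<Inter>(range D)" using KD by (rule INF_mono')
      then have "(\<Inter>n. K n) = (\<Inter>n. K n \<inter> e ` topspace X)" unfolding D by auto
      also have "\<dots> = (\<Inter>n. e ` C n)" by (simp only: KC)
      also have "\<dots> = e ` (\<Inter>n. C n)"
        using C_sub by (intro image_INT[OF inj, symmetric, of UNIV _ 0]) auto
      finally show ?thesis .
    qed
    have clK: "closedin B (K n)" for n by (simp add: K_def)
    have "(\<Inter>n. K n) \<noteq> {}"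
    proof (rule compact_space_imp_nest[OF \<open>compact_space B\<close> clK])
      show "K n \<noteq> {}" for n
        using C_ne[of n] KC[of n] by auto
      have "decseq C" using C_dec by (simp add: decseq_Suc_iff)
      then show "decseq K" unfolding K_def decseq_def
        by (simp add: closure_of_mono image_mono)
    qed
    then show "(\<Inter>n. C n) \<noteq> {}" using eq by auto
    have "closedin B (\<Inter>n. K n)" using clK by blast
    then have "compactin B (e ` (\<Inter>n. C n))"
      using eq \<open>compact_space B\<close> closedin_compact_space by metis
    then have "compactin (subtopology B (e ` topspace X)) (e ` (\<Inter>n. C n))"
      using C_sub[of 0] by (auto simp: compactin_subtopology)
    then show "compactin X (\<Inter>n. C n)"
      using homeomorphic_map_compactness_eq[OF hom, of "\<Inter>n. C n"] C_sub[of 0] by auto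
  qed
  then show ?thesis by blast
qed

section \<open>Passage from the Stone-Cech compactification to covers\<close>

lemma unit_functions_eq:
  "unit_functions X = mspace (submetric (cfunspace X euclidean_metric) {f. f \<in> topspace X \<rightarrow> {0..1}})"
proof -
  have "bounded (f ` topspace X)" if "f \<in> topspace X \<rightarrow> {0..1::real}" for f
    by (metis bounded_closed_interval bounded_subset image_subset_iff_funcset that)
  then show ?thesis
    by (auto simp: unit_functions_def continuous_map_in_subtopology)
qed

lemma Cech_complete_cover_complete:
  assumes "Cech_complete_space X"
  shows "\<exists>\<U>. cover_complete X \<U>"
proof (rule cover_complete_embedding)
  define Q where "Q = product_topology (\<lambda>_. top_of_set {0..1::real}) (unit_functions X)"
  have S: "stone_cech X = subtopology Q (Q closure_of (stone_cech_map X ` topspace X))"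
    by (simp add: stone_cech_def Q_def Let_def)
  have cQ: "compact_space Q"
    by (simp add: Q_def compact_space_product_topology compact_space_subtopology)
  have hQ: "Hausdorff_space Q"
    by (simp add: Q_def Hausdorff_space_product_topology Hausdorff_space_subtopology)
  have eQ: "embedding_map X Q (stone_cech_map X)"
    using completely_regular_space_cube_embedding_explicit[of X] assms
    unfolding Q_def stone_cech_map_def unit_functions_eq Cech_complete_space_def by blast
  then have "continuous_map X Q (stone_cech_map X)"
    unfolding embedding_map_def
    using continuous_map_into_fulltopology homeomorphic_imp_continuous_map by blast
  then have "stone_cech_map X ` topspace X \<subseteq> topspace Q"
    by (rule continuous_map_image_subset_topspace)
  then have "stone_cech_map X ` topspace X \<subseteq> Q closure_of (stone_cech_map X ` topspace X)"
    by (rule closure_of_subset)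
  then show "embedding_map X (stone_cech X) (stone_cech_map X)"
    unfolding S by (simp add: eQ embedding_map_in_subtopology image_subset_iff_funcset)
  show "compact_space (stone_cech X)"
    unfolding S using cQ by (simp add: closedin_compact_space compact_space_subtopology)
  show "Hausdorff_space (stone_cech X)"
    unfolding S using hQ by (rule Hausdorff_space_subtopology)
  show "gdelta_in (stone_cech X) (stone_cech_map X ` topspace X)"
    using assms by (simp add: Cech_complete_space_def)
qed

section \<open>Baire category and equicontinuity\<close>

lemma cover_complete_shrink:
  assumes "regular_space X" and X: "cover_complete X \<U>" and W: "openin X W" "W \<noteq> {}"
  obtains W' where "openin X W'" "W' \<noteq> {}" "X closure_of W' \<subseteq> W" "\<exists>U\<in>\<U> n. X closure_of W' \<subseteq> U"
proof -
  obtain x where x: "x \<in> W" using W by blast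
  then have "x \<in> \<Union>(\<U> n)"
    using cover_complete_cover[OF X] openin_subset[OF W(1)] by blast
  then obtain U where U: "U \<in> \<U> n" "x \<in> U" by blast
  then have "openin X (W \<inter> U)" "x \<in> W \<inter> U"
    using W x cover_complete_open[OF X] by auto
  then obtain V K where V: "openin X V" "closedin X K" "x \<in> V" "V \<subseteq> K" "K \<subseteq> W \<inter> U"
    using \<open>regular_space X\<close>[folded neighbourhood_base_of_closedin, unfolded neighbourhood_base_of,
        rule_format, of "W \<inter> U" x] by blast
  then have "X closure_of V \<subseteq> K"
    by (simp add: closure_of_minimal)
  with V U show thesis
    by (intro that[of V]) (blast intro: order_trans)+
qed

lemma openin_subset_closure_of: "openin X W \<Longrightarrow> W \<subseteq> X closure_of W"
  by (simp add: closure_of_subset openin_subset)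

text \<open>Nested open sets \<open>W n\<close> with \<open>P n (W n)\<close> are chosen, each with
  closure inside the previous set and inside a member of \<open>\<U> n\<close>; completeness gives a
  common point.\<close>

lemma cover_complete_Baire:
  assumes reg: "regular_space X" and X: "cover_complete X \<U>" and V: "openin X V" "V \<noteq> {}"
    and dense: "\<And>n W. \<lbrakk>openin X W; W \<noteq> {}; W \<subseteq> V\<rbrakk> \<Longrightarrow> \<exists>W'. openin X W' \<and> W' \<noteq> {} \<and> W' \<subseteq> W \<and> P n W'"
  shows "\<exists>x\<in>V. \<forall>n::nat. \<exists>W. openin X W \<and> x \<in> W \<and> P n W"
proof -
  define good where "good n W \<longleftrightarrow> openin X W \<and> W \<noteq> {} \<and> X closure_of W \<subseteq> V \<and> P n W \<and>
      (\<exists>U\<in>\<U> n. X closure_of W \<subseteq> U)" for n W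
  have step: "\<exists>W'. good n W' \<and> X closure_of W' \<subseteq> W"
    if W: "openin X W" "W \<noteq> {}" "W \<subseteq> V" for n W
  proof -
    \<comment> \<open>Shrinking comes before \<open>dense\<close>, because \<open>P n\<close> need
      not pass to smaller open sets.\<close>
    obtain W1 where W1: "openin X W1" "W1 \<noteq> {}" "X closure_of W1 \<subseteq> W" "\<exists>U\<in>\<U> n. X closure_of W1 \<subseteq> U"
      by (rule cover_complete_shrink[OF reg X W(1,2)])
    have "W1 \<subseteq> V"
      using openin_subset_closure_of[OF W1(1)] W1(3) W(3) by blast
    then obtain W' where W': "openin X W'" "W' \<noteq> {}" "W' \<subseteq> W1" "P n W'"
      using dense[OF W1(1,2)] by blast
    have "X closure_of W' \<subseteq> X closure_of W1"
      using W'(3) by (rule closure_of_mono)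
    then have "X closure_of W' \<subseteq> W" "\<exists>U\<in>\<U> n. X closure_of W' \<subseteq> U"
      using W1(3,4) by (meson order_trans)+
    then show ?thesis
      using W' W(3) unfolding good_def by (intro exI[of _ W'] conjI) auto
  qed
  have sub: "W \<subseteq> V" if "good n W" for n W
    using that openin_subset_closure_of[of X W] unfolding good_def by blast
  have "\<exists>W. \<forall>n. good n (W n) \<and> X closure_of (W (Suc n)) \<subseteq> W n"
  proof (rule dependent_nat_choice)
    show "\<exists>W. good 0 W" using step[OF V] by blast
    show "\<exists>W'. good (Suc n) W' \<and> X closure_of W' \<subseteq> W" if "good n W" for W n
      using step[of W "Suc n"] that sub[OF that] unfolding good_def by blast
  qed
  then obtain W where W: "good n (W n)" "X closure_of (W (Suc n)) \<subseteq> W n" for n by blast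
  have "(\<Inter>n. X closure_of (W n)) \<noteq> {}"
  proof (rule cover_complete_nest(2)[OF X])
    show "closedin X (X closure_of W n)" for n by simp
    show "X closure_of W n \<noteq> {}" for n
      using W(1)[of n] openin_subset_closure_of[of X "W n"] unfolding good_def by blast
    show "X closure_of W (Suc n) \<subseteq> X closure_of W n" for n
      using W[of n] openin_subset_closure_of[of X "W n"] unfolding good_def by blast
    show "\<exists>\<V>. finite \<V> \<and> \<V> \<subseteq> \<U> n \<and> X closure_of W n \<subseteq> \<Union>\<V>" for n
    proof -
      obtain U where "U \<in> \<U> n" "X closure_of W n \<subseteq> U" using W(1)[of n] unfolding good_def by blast
      then show ?thesis by (intro exI[of _ "{U}"]) auto
    qed
  qed
  then obtain x where x: "x \<in> (\<Inter>n. X closure_of (W n))" by blast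
  have xW: "x \<in> W n" for n using W(2)[of n] x by blast
  show ?thesis
  proof (intro bexI[of _ x] allI)
    show "x \<in> V" using sub[OF W(1)] xW by blast
    show "\<exists>W. openin X W \<and> x \<in> W \<and> P n W" for n
      using W(1)[of n] xW[of n] unfolding good_def by blast
  qed
qed

lemma equicontinuity_pointI:
  assumes "x \<in> topspace X"
    and "\<And>\<epsilon>. \<epsilon> > 0 \<Longrightarrow> \<exists>U. openin X U \<and> x \<in> U \<and> (\<forall>g\<in>G. \<forall>y\<in>U. \<forall>z\<in>U. d (g y) (g z) \<le> \<epsilon>)"
  shows "equicontinuity_point X d G x"
  unfolding equicontinuity_point_def
proof (intro conjI allI impI assms(1))
  fix \<epsilon> :: real assume "\<epsilon> > 0"
  \<comment> \<open>Half of \<open>\<epsilon>\<close> is used because only a non-strict bound passes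
    to the supremum.\<close>
  then obtain U where U: "openin X U" "x \<in> U" "\<forall>g\<in>G. \<forall>y\<in>U. \<forall>z\<in>U. d (g y) (g z) \<le> \<epsilon>/2"
    using assms(2)[of "\<epsilon>/2"] by auto
  have "ediameter d (g ` U) < ennreal \<epsilon>" if "g \<in> G" for g
  proof -
    have "ediameter d (g ` U) \<le> ennreal (\<epsilon>/2)"
      unfolding ediameter_def using U(3) that by (auto intro!: SUP_least ennreal_leI)
    also have "\<dots> < ennreal \<epsilon>" using \<open>\<epsilon> > 0\<close> by (simp add: ennreal_less_iff)
    finally show ?thesis .
  qed
  with U show "\<exists>U. openin X U \<and> x \<in> U \<and> (\<forall>g\<in>G. ediameter d (g ` U) < ennreal \<epsilon>)" by blast
qed

lemma ediameter_less_imp: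
  assumes "ediameter d (g ` U) < ennreal \<epsilon>" "x \<in> U" "y \<in> U"
  shows "d (g x) (g y) < \<epsilon>"
proof -
  have "ennreal (d (g x) (g y)) \<le> ediameter d (g ` U)"
    unfolding ediameter_def using assms by (intro SUP_upper2[of "(g x, g y)"]) auto
  then have "ennreal (d (g x) (g y)) < ennreal \<epsilon>"
    using assms(1) by simp
  then show ?thesis
    by (meson ennreal_leI leD leI)
qed

text \<open>Otherwise, at every scale, each nonempty open set contains one on which all of
  \<open>G\<close> oscillates little; the Baire property then yields an equicontinuity point outside
  the closure of all equicontinuity points.\<close>

lemma not_almost_equicontinuous_imp_oscillation:
  assumes reg: "regular_space X" and X: "cover_complete X \<U>" and nae: "\<not> almost_equicontinuous X d G"
  shows "\<exists>\<epsilon>>0. \<exists>V. openin X V \<and> V \<noteq> {} \<and>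
           (\<forall>W. openin X W \<and> W \<noteq> {} \<and> W \<subseteq> V \<longrightarrow> (\<exists>g\<in>G. \<exists>x\<in>W. \<exists>y\<in>W. d (g x) (g y) > \<epsilon>))"
proof (rule ccontr)
  assume "\<not> ?thesis"
  then have neg: "\<exists>W. openin X W \<and> W \<noteq> {} \<and> W \<subseteq> V \<and> (\<forall>g\<in>G. \<forall>x\<in>W. \<forall>y\<in>W. d (g x) (g y) \<le> \<epsilon>)"
    if "\<epsilon> > 0" "openin X V" "V \<noteq> {}" for \<epsilon> V
    using that by (meson leI)
  define E where "E = {x. equicontinuity_point X d G x}"
  define V where "V = topspace X - X closure_of E"
  have V: "openin X V" "V \<noteq> {}"
    using nae closure_of_subset_topspace[of X E]
    unfolding V_def almost_equicontinuous_def E_def[symmetric] by auto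
  have "\<exists>x\<in>V. \<forall>n::nat. \<exists>W. openin X W \<and> x \<in> W \<and>
      (\<forall>g\<in>G. \<forall>x\<in>W. \<forall>y\<in>W. d (g x) (g y) \<le> 1 / real (Suc n))"
  proof (rule cover_complete_Baire[OF reg X V])
    fix n W assume "openin X W" "W \<noteq> {}" "W \<subseteq> V"
    then show "\<exists>W'. openin X W' \<and> W' \<noteq> {} \<and> W' \<subseteq> W \<and>
        (\<forall>g\<in>G. \<forall>x\<in>W'. \<forall>y\<in>W'. d (g x) (g y) \<le> 1 / real (Suc n))"
      by (intro neg) auto
  qed
  then obtain x where x: "x \<in> V" and Wx: "\<And>n::nat. \<exists>W. openin X W \<and> x \<in> W \<and>
      (\<forall>g\<in>G. \<forall>x\<in>W. \<forall>y\<in>W. d (g x) (g y) \<le> 1 / real (Suc n))" by blast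
  have "equicontinuity_point X d G x"
  proof (rule equicontinuity_pointI)
    show "x \<in> topspace X" using x by (simp add: V_def)
    fix \<epsilon> :: real assume "\<epsilon> > 0"
    then obtain n where n: "1 / real (Suc n) < \<epsilon>"
      using nat_approx_posE by blast
    obtain W where W: "openin X W" "x \<in> W" "\<forall>g\<in>G. \<forall>y\<in>W. \<forall>z\<in>W. d (g y) (g z) \<le> 1 / real (Suc n)"
      using Wx by blast
    then have "\<forall>g\<in>G. \<forall>y\<in>W. \<forall>z\<in>W. d (g y) (g z) \<le> \<epsilon>"
      using n by (meson less_eq_real_def order_trans)
    with W show "\<exists>U. openin X U \<and> x \<in> U \<and> (\<forall>g\<in>G. \<forall>y\<in>U. \<forall>z\<in>U. d (g y) (g z) \<le> \<epsilon>)" by blast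
  qed
  then have "x \<in> E" by (simp add: E_def)
  moreover have "E \<subseteq> topspace X" by (auto simp: E_def equicontinuity_point_def)
  ultimately have "x \<in> X closure_of E" using closure_of_subset by blast
  then show False using x by (simp add: V_def)
qed

section \<open>Separating pairs of functions\<close>

context Metric_space
begin

text \<open>Each \<open>g\<close> is coded by centres of balls containing its values on
  \<open>E\<close>. There are finitely many codes, and functions with equal codes are
  \<open>\<eta>\<close>-close on \<open>E\<close>, so one function per code suffices.\<close>

lemma finite_pointwise_net:
  assumes "finite E" and "0 < \<eta>" and tb: "\<And>e. e \<in> E \<Longrightarrow> mtotally_bounded ((\<lambda>g. g e) ` G)"
  shows "\<exists>\<Gamma>. finite \<Gamma> \<and> \<Gamma> \<subseteq> G \<and> (\<forall>g\<in>G. \<exists>\<gamma>\<in>\<Gamma>. \<forall>e\<in>E. d (g e) (\<gamma> e) < \<eta>)"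
proof -
  have "\<exists>N. finite N \<and> N \<subseteq> (\<lambda>g. g e) ` G \<and> (\<lambda>g. g e) ` G \<subseteq> (\<Union>x\<in>N. mball x (\<eta>/2))" if "e \<in> E" for e
    using tb[OF that] half_gt_zero[OF \<open>0 < \<eta>\<close>] unfolding mtotally_bounded_def by blast
  then obtain N where fin: "\<And>e. e \<in> E \<Longrightarrow> finite (N e)"
    and N: "\<And>e. e \<in> E \<Longrightarrow> (\<lambda>g. g e) ` G \<subseteq> (\<Union>x\<in>N e. mball x (\<eta>/2))"
    by metis
  define c where "c e g = (SOME x. x \<in> N e \<and> g e \<in> mball x (\<eta>/2))" for e g
  have "\<exists>x\<in>N e. g e \<in> mball x (\<eta>/2)" if "e \<in> E" "g \<in> G" for e g
    using N[OF that(1)] that(2) by blast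
  then have c: "c e g \<in> N e \<and> g e \<in> mball (c e g) (\<eta>/2)" if "e \<in> E" "g \<in> G" for e g
    using someI_ex[of "\<lambda>x. x \<in> N e \<and> g e \<in> mball x (\<eta>/2)"] that unfolding c_def Bex_def by blast
  define \<Phi> where "\<Phi> g = (\<lambda>e\<in>E. c e g)" for g
  have "\<Phi> ` G \<subseteq> PiE E N"
    using c by (simp add: \<Phi>_def image_subset_iff)
  then have "finite (\<Phi> ` G)"
    by (rule finite_subset[OF _ finite_PiE[OF \<open>finite E\<close> fin]])
  then obtain \<Gamma> where \<Gamma>: "\<Gamma> \<subseteq> G" "finite \<Gamma>" "\<Phi> ` G = \<Phi> ` \<Gamma>"
    using finite_subset_image[of "\<Phi> ` G" \<Phi> G] by blast
  have "\<exists>\<gamma>\<in>\<Gamma>. \<forall>e\<in>E. d (g e) (\<gamma> e) < \<eta>" if g: "g \<in> G" for g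
  proof -
    obtain \<gamma> where \<gamma>: "\<gamma> \<in> \<Gamma>" "\<Phi> g = \<Phi> \<gamma>" using \<Gamma>(3) g by blast
    have "d (g e) (\<gamma> e) < \<eta>" if e: "e \<in> E" for e
    proof -
      have "c e g = c e \<gamma>" using fun_cong[OF \<gamma>(2), of e] e by (simp add: \<Phi>_def)
      then have "g e \<in> mball (c e g) (\<eta>/2)" "\<gamma> e \<in> mball (c e g) (\<eta>/2)"
        using c[OF e g] c[OF e, of \<gamma>] \<gamma>(1) \<Gamma>(1) by auto
      then show ?thesis
        using triangle'[of "g e" "c e g" "\<gamma> e"]
          commute[of "g e" "c e g"] commute[of "\<gamma> e" "c e g"] by (simp add: in_mball)
    qed
    then show ?thesis using \<gamma>(1) by blast
  qed
  with \<Gamma> show ?thesis by blast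
qed

lemma continuous_map_mdist:
  assumes f: "continuous_map X mtopology f" and g: "continuous_map X mtopology g"
  shows "continuous_map X euclideanreal (\<lambda>x. d (f x) (g x))"
proof -
  have "\<exists>U. openin X U \<and> x \<in> U \<and> (\<forall>y\<in>U. dist (d (f x) (g x)) (d (f y) (g y)) < \<epsilon>)"
    if x: "x \<in> topspace X" and "\<epsilon> > 0" for x \<epsilon>
  proof -
    have "\<epsilon>/2 > 0" using \<open>\<epsilon> > 0\<close> by simp
    then obtain U V where U: "openin X U" "x \<in> U" "\<And>y. y \<in> U \<Longrightarrow> f y \<in> mball (f x) (\<epsilon>/2)"
      and V: "openin X V" "x \<in> V" "\<And>y. y \<in> V \<Longrightarrow> g y \<in> mball (g x) (\<epsilon>/2)"
      using f g x unfolding continuous_map_to_metric by meson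
    have "dist (d (f x) (g x)) (d (f y) (g y)) < \<epsilon>" if "y \<in> U \<inter> V" for y
    proof -
      have m: "f x \<in> M" "f y \<in> M" "g x \<in> M" "g y \<in> M" "d (f x) (f y) < \<epsilon>/2" "d (g x) (g y) < \<epsilon>/2"
        using U(3)[of y] V(3)[of y] that by (auto simp: in_mball)
      have "d (f x) (g x) \<le> d (f x) (f y) + d (f y) (g y) + d (g x) (g y)"
        using triangle[OF m(1,2,3)] triangle[OF m(2,4,3)] commute[of "g y" "g x"] by linarith
      moreover have "d (f y) (g y) \<le> d (f x) (f y) + d (f x) (g x) + d (g x) (g y)"
        using triangle[OF m(2,1,4)] triangle[OF m(1,3,4)] commute[of "f y" "f x"] by linarith
      ultimately show ?thesis
        using m(5,6) unfolding dist_real_def by linarith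
    qed
    with U V show ?thesis by (intro exI[of _ "U \<inter> V"]) auto
  qed
  then have "continuous_map X Met_TC.mtopology (\<lambda>x. d (f x) (g x))"
    unfolding Met_TC.continuous_map_to_metric by (simp add: Met_TC.in_mball)
  then show ?thesis by simp
qed

lemma openin_mdist:
  assumes "continuous_map X mtopology f" "continuous_map X mtopology g"
  shows "openin X {x \<in> topspace X. d (f x) (g x) < r}" "openin X {x \<in> topspace X. d (f x) (g x) > r}"
  using openin_continuous_map_preimage[OF continuous_map_mdist[OF assms], of "{..<r}"]
    openin_continuous_map_preimage[OF continuous_map_mdist[OF assms], of "{r<..}"] by simp_all

text \<open>If this failed, a finite net of \<open>G\<close> for the points of \<open>E\<close> would control the oscillation of
  all of \<open>G\<close> on \<open>W\<close>, and \<open>W\<close> could be shrunk until this oscillation is at most \<open>3\<epsilon>\<close>.\<close>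

lemma exists_separating_pair:
  assumes cont: "\<And>g. g \<in> G \<Longrightarrow> continuous_map X mtopology g"
    and tb: "\<And>x. x \<in> topspace X \<Longrightarrow> mtotally_bounded ((\<lambda>g. g x) ` G)"
    and "0 < \<epsilon>" "0 < \<eta>" and "finite E" "E \<subseteq> topspace X" and W: "openin X W" "W \<noteq> {}"
    and osc: "\<And>W'. \<lbrakk>openin X W'; W' \<noteq> {}; W' \<subseteq> W\<rbrakk> \<Longrightarrow> \<exists>g\<in>G. \<exists>x\<in>W'. \<exists>y\<in>W'. d (g x) (g y) > 3 * \<epsilon>"
  shows "\<exists>x\<in>W. \<exists>g\<in>G. \<exists>h\<in>G. (\<forall>e\<in>E. d (g e) (h e) < \<eta>) \<and> d (g x) (h x) > \<epsilon>"
proof (rule ccontr)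
  assume "\<not> ?thesis"
  then have close: "d (g x) (h x) \<le> \<epsilon>"
    if "x \<in> W" "g \<in> G" "h \<in> G" "\<And>e. e \<in> E \<Longrightarrow> d (g e) (h e) < \<eta>" for x g h
    using that by (meson leI)
  have "mtotally_bounded ((\<lambda>g. g e) ` G)" if "e \<in> E" for e
    by (rule tb) (use that \<open>E \<subseteq> topspace X\<close> in blast)
  from finite_pointwise_net[OF \<open>finite E\<close> \<open>0 < \<eta>\<close> this]
  obtain \<Gamma> where \<Gamma>: "finite \<Gamma>" "\<Gamma> \<subseteq> G" "\<And>g. g \<in> G \<Longrightarrow> \<exists>\<gamma>\<in>\<Gamma>. \<forall>e\<in>E. d (g e) (\<gamma> e) < \<eta>"
    by metis
  obtain x0 where x0: "x0 \<in> W" using W by blast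
  have WX: "W \<subseteq> topspace X" using W(1) by (rule openin_subset)
  have inM: "g x \<in> M" if "g \<in> G" "x \<in> W" for g x
    using continuous_map_image_subset_topspace[OF cont[OF that(1)]] that(2) WX by auto
  \<comment> \<open>On \<open>V\<close> every net member stays within \<open>\<epsilon>/2\<close> of
    its value at \<open>x0\<close>. A function within \<open>\<epsilon>\<close> of a net member
    therefore varies by less than \<open>3 * \<epsilon>\<close> on \<open>V\<close>.\<close>
  define V where "V = W \<inter> (\<Inter>\<gamma>\<in>\<Gamma>. {x \<in> topspace X. d (\<gamma> x) (\<gamma> x0) < \<epsilon>/2})"
  have "openin X V"
  \<comment> \<open>For empty \<open>\<Gamma>\<close> the intersection is \<open>UNIV\<close>, so
    \<open>V = W\<close>.\<close>
  proof (cases "\<Gamma> = {}")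
    case False
    have "openin X {x \<in> topspace X. d (\<gamma> x) (\<gamma> x0) < \<epsilon>/2}" if "\<gamma> \<in> \<Gamma>" for \<gamma>
      using that \<Gamma>(2) inM x0 cont by (intro openin_mdist(1)) (auto simp: subset_iff)
    then show ?thesis
      unfolding V_def using False \<Gamma>(1) W(1) by (intro openin_Int openin_INT) auto
  qed (simp add: V_def W(1))
  moreover have "x0 \<in> V"
    using x0 WX \<Gamma>(2) inM \<open>0 < \<epsilon>\<close> by (auto simp: V_def)
  moreover have VW: "V \<subseteq> W" by (simp add: V_def)
  ultimately obtain g x y where g: "g \<in> G" "x \<in> V" "y \<in> V" "d (g x) (g y) > 3 * \<epsilon>"
    using osc[of V] by blast
  obtain \<gamma> where \<gamma>: "\<gamma> \<in> \<Gamma>" "\<forall>e\<in>E. d (g e) (\<gamma> e) < \<eta>" using \<Gamma>(3)[OF g(1)] by blast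
  have "\<gamma> \<in> G" using \<gamma>(1) \<Gamma>(2) by blast
  have xyW: "x \<in> W" "y \<in> W" using g VW by auto
  have "d (g x) (\<gamma> x) \<le> \<epsilon>" "d (g y) (\<gamma> y) \<le> \<epsilon>"
    using close[of _ g \<gamma>] xyW g(1) \<open>\<gamma> \<in> G\<close> \<gamma>(2) by auto
  moreover have "d (\<gamma> x) (\<gamma> x0) < \<epsilon>/2" "d (\<gamma> y) (\<gamma> x0) < \<epsilon>/2"
    using g(2,3) \<gamma>(1) by (auto simp: V_def)
  moreover have "d (g x) (g y) \<le> d (g x) (\<gamma> x) + d (\<gamma> x) (\<gamma> x0) + d (\<gamma> y) (\<gamma> x0) + d (g y) (\<gamma> y)"
    using triangle[of "g x" "\<gamma> x" "g y"] triangle[of "\<gamma> x" "\<gamma> x0" "g y"] triangle[of "\<gamma> x0" "\<gamma> y" "g y"]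
      commute[of "g y" "\<gamma> y"] commute[of "\<gamma> x0" "\<gamma> y"] inM xyW x0 g(1) \<open>\<gamma> \<in> G\<close> by simp
  ultimately show False using g(4) by linarith
qed

definition separates :: "real \<Rightarrow> real \<Rightarrow> ('i \<Rightarrow> 'b set) \<Rightarrow> 'i set \<Rightarrow> 'i \<Rightarrow> ('b \<Rightarrow> 'a) \<Rightarrow> ('b \<Rightarrow> 'a) \<Rightarrow> bool" where
  "separates \<epsilon> \<eta> W I i g h \<longleftrightarrow>
     (\<forall>x\<in>W i. d (g x) (h x) > \<epsilon>) \<and> (\<forall>j\<in>I - {i}. \<forall>x\<in>W j. d (g x) (h x) < \<eta>)"

lemma separates_mono:
  assumes "separates \<epsilon> \<eta> W I i g h" "i \<in> I" "\<And>j. j \<in> I \<Longrightarrow> W' j \<subseteq> W j"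
  shows "separates \<epsilon> \<eta> W' I i g h"
  using assms unfolding separates_def by blast

text \<open>The indices are treated one after another: making room for a new pair only shrinks the
  sets, and pairs already found keep separating on smaller sets.\<close>

lemma exists_separating_refinement:
  assumes cont: "\<And>g. g \<in> G \<Longrightarrow> continuous_map X mtopology g"
    and tb: "\<And>x. x \<in> topspace X \<Longrightarrow> mtotally_bounded ((\<lambda>g. g x) ` G)"
    and "0 < \<epsilon>" "0 < \<eta>"
    and osc: "\<And>W'. \<lbrakk>openin X W'; W' \<noteq> {}; W' \<subseteq> V\<rbrakk> \<Longrightarrow> \<exists>g\<in>G. \<exists>x\<in>W'. \<exists>y\<in>W'. d (g x) (g y) > 3 * \<epsilon>"
    and "finite I" and W: "\<And>i. i \<in> I \<Longrightarrow> openin X (W i) \<and> W i \<noteq> {} \<and> W i \<subseteq> V"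
  shows "\<exists>W' g h. \<forall>i\<in>I. openin X (W' i) \<and> W' i \<noteq> {} \<and> W' i \<subseteq> W i \<and> g i \<in> G \<and> h i \<in> G \<and>
           separates \<epsilon> \<eta> W' I i (g i) (h i)"
proof -
  have step: "\<exists>W' g h. g \<in> G \<and> h \<in> G \<and> (\<forall>j\<in>I. openin X (W' j) \<and> W' j \<noteq> {} \<and> W' j \<subseteq> W j) \<and>
      separates \<epsilon> \<eta> W' I i g h"
    if W: "\<And>i. i \<in> I \<Longrightarrow> openin X (W i) \<and> W i \<noteq> {} \<and> W i \<subseteq> V" and i: "i \<in> I" for W i
  proof -
    \<comment> \<open>One point is kept in each set. A pair that nearly agrees at the points
      \<open>e j\<close> with \<open>j \<noteq> i\<close> does so, by continuity, on nonempty open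
      parts of the sets \<open>W j\<close>.\<close>
    define e where "e j = (SOME x. x \<in> W j)" for j
    have e: "e j \<in> W j" if "j \<in> I" for j
      using W[OF that] by (simp add: e_def some_in_eq)
    have eX: "e j \<in> topspace X" if "j \<in> I" for j
      using e[OF that] W[OF that] openin_subset by blast
    have "\<exists>x\<in>W i. \<exists>g\<in>G. \<exists>h\<in>G. (\<forall>e\<in>e ` (I - {i}). d (g e) (h e) < \<eta>) \<and> d (g x) (h x) > \<epsilon>"
    proof (rule exists_separating_pair[OF cont tb \<open>0 < \<epsilon>\<close> \<open>0 < \<eta>\<close>])
      show "\<exists>g\<in>G. \<exists>x\<in>W'. \<exists>y\<in>W'. d (g x) (g y) > 3 * \<epsilon>"
        if "openin X W'" "W' \<noteq> {}" "W' \<subseteq> W i" for W'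
        using osc[OF that(1,2)] that(3) W[OF i] by blast
    qed (use W[OF i] eX \<open>finite I\<close> in auto)
    then obtain x g h where x: "x \<in> W i" "d (g x) (h x) > \<epsilon>" and gh: "g \<in> G" "h \<in> G"
      and small: "\<And>j. j \<in> I - {i} \<Longrightarrow> d (g (e j)) (h (e j)) < \<eta>" by blast
    define W' where "W' j = W j \<inter> (if j = i then {x \<in> topspace X. d (g x) (h x) > \<epsilon>}
        else {x \<in> topspace X. d (g x) (h x) < \<eta>})" for j
    have "openin X (W' j) \<and> W' j \<noteq> {} \<and> W' j \<subseteq> W j" if j: "j \<in> I" for j
    proof (intro conjI)
      show "openin X (W' j)"
        unfolding W'_def using W[OF j] openin_mdist[OF cont[OF gh(1)] cont[OF gh(2)]] by auto
      have "(if j = i then x else e j) \<in> W' j"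
        using x e[OF j] eX[OF j] small[of j] W[OF i] openin_subset[of X "W i"] j by (auto simp: W'_def)
      then show "W' j \<noteq> {}" by blast
    qed (simp add: W'_def)
    moreover have "separates \<epsilon> \<eta> W' I i g h"
      by (auto simp: separates_def W'_def)
    ultimately show ?thesis using gh by blast
  qed
  have "\<exists>W' g h. (\<forall>j\<in>I. openin X (W' j) \<and> W' j \<noteq> {} \<and> W' j \<subseteq> W j) \<and>
      (\<forall>i\<in>J. g i \<in> G \<and> h i \<in> G \<and> separates \<epsilon> \<eta> W' I i (g i) (h i))" if "finite J" "J \<subseteq> I" for J
    using that
  proof (induction J rule: finite_induct)
    case empty
    show ?case using W by (intro exI[of _ W]) auto
  next
    case (insert i J)
    have "J \<subseteq> I" using insert.prems by simp
    from insert.IH[OF this] obtain W1 g h where IH: "\<forall>j\<in>I. openin X (W1 j) \<and> W1 j \<noteq> {} \<and> W1 j \<subseteq> W j"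
      "\<forall>i\<in>J. g i \<in> G \<and> h i \<in> G \<and> separates \<epsilon> \<eta> W1 I i (g i) (h i)"
      by blast
    note W1 = bspec[OF IH(1)] and gh = bspec[OF IH(2)]
    have "openin X (W1 j) \<and> W1 j \<noteq> {} \<and> W1 j \<subseteq> V" if "j \<in> I" for j
      using W1[OF that] W[OF that] by blast
    moreover have "i \<in> I" using insert.prems by simp
    ultimately obtain W2 g' h' where g': "g' \<in> G" "h' \<in> G" "separates \<epsilon> \<eta> W2 I i g' h'"
      and W2: "\<forall>j\<in>I. openin X (W2 j) \<and> W2 j \<noteq> {} \<and> W2 j \<subseteq> W1 j" using step[of W1 i] by blast
    have "separates \<epsilon> \<eta> W2 I k (g k) (h k)" if "k \<in> J" for k
      by (rule separates_mono[of _ _ W1]) (use gh[OF that] that insert.prems W2 in auto)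
    then have "\<forall>k\<in>insert i J. (g(i := g')) k \<in> G \<and> (h(i := h')) k \<in> G \<and>
        separates \<epsilon> \<eta> W2 I k ((g(i := g')) k) ((h(i := h')) k)"
      using g' gh by simp
    moreover have "\<forall>j\<in>I. openin X (W2 j) \<and> W2 j \<noteq> {} \<and> W2 j \<subseteq> W j"
      using W1 W2 by (meson order_trans)
    ultimately show ?case by blast
  qed
  from this[OF \<open>finite I\<close> order_refl] show ?thesis by blast
qed

end

section \<open>Separating Cantor schemes\<close>

text \<open>A Cantor scheme over binary words. The sets of words of length \<open>Suc n\<close> are
  small for \<open>\<U> n\<close>, so that completeness applies along branches and levels. Pairs
  belong to nonempty words, as the empty word has no sibling. The tolerance in \<open>near\<close>
  tends to 0 with the length, so that limits of pairs along a branch agree exactly off it.\<close>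

locale separating_scheme = Metric_space M d
  for M :: "'a set" and d :: "'a \<Rightarrow> 'a \<Rightarrow> real" +
  fixes X :: "'b topology" and \<U> :: "nat \<Rightarrow> 'b set set" and G :: "('b \<Rightarrow> 'a) set" and \<epsilon> :: real
    and C :: "bool list \<Rightarrow> 'b set" and g h :: "bool list \<Rightarrow> 'b \<Rightarrow> 'a"
  assumes complete: "cover_complete X \<U>"
    and eps_pos: "0 < \<epsilon>"
    and C_closed: "closedin X (C s)"
    and C_nonempty: "C s \<noteq> {}"
    and C_append: "C (s @ [b]) \<subseteq> C s"
    and C_small: "length s = Suc n \<Longrightarrow> \<exists>U\<in>\<U> n. C s \<subseteq> U"
    and g_in: "s \<noteq> [] \<Longrightarrow> g s \<in> G"
    and h_in: "s \<noteq> [] \<Longrightarrow> h s \<in> G"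
    and far: "\<lbrakk>s \<noteq> []; x \<in> C s\<rbrakk> \<Longrightarrow> \<epsilon> < d (g s x) (h s x)"
    and near: "\<lbrakk>s \<noteq> []; length t = length s; t \<noteq> s; x \<in> C t\<rbrakk> \<Longrightarrow> d (g s x) (h s x) < \<epsilon> / real (Suc (length s))"

section \<open>Construction of a separating scheme\<close>

context Metric_space
begin

text \<open>Separation is first achieved on open sets \<open>W1 i\<close>; passing to closures
  inside them keeps it and adds smallness for the cover.\<close>

lemma exists_closed_separating_refinement:
  assumes reg: "regular_space X" and X: "cover_complete X \<U>"
    and cont: "\<And>g. g \<in> G \<Longrightarrow> continuous_map X mtopology g"
    and tb: "\<And>x. x \<in> topspace X \<Longrightarrow> mtotally_bounded ((\<lambda>g. g x) ` G)"
    and "0 < \<epsilon>" "0 < \<eta>"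
    and osc: "\<And>W'. \<lbrakk>openin X W'; W' \<noteq> {}; W' \<subseteq> V\<rbrakk> \<Longrightarrow> \<exists>g\<in>G. \<exists>x\<in>W'. \<exists>y\<in>W'. d (g x) (g y) > 3 * \<epsilon>"
    and "finite I" and W: "\<And>i. i \<in> I \<Longrightarrow> openin X (W i) \<and> W i \<noteq> {} \<and> W i \<subseteq> V"
  shows "\<exists>W' g h. \<forall>i\<in>I. openin X (W' i) \<and> W' i \<noteq> {} \<and> X closure_of W' i \<subseteq> W i \<and>
           (\<exists>U\<in>\<U> n. X closure_of W' i \<subseteq> U) \<and> g i \<in> G \<and> h i \<in> G \<and>
           separates \<epsilon> \<eta> (\<lambda>j. X closure_of W' j) I i (g i) (h i)"
proof -
  have "\<exists>W1 g h. \<forall>i\<in>I. openin X (W1 i) \<and> W1 i \<noteq> {} \<and> W1 i \<subseteq> W i \<and> g i \<in> G \<and> h i \<in> G \<and>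
      separates \<epsilon> \<eta> W1 I i (g i) (h i)"
    by (rule exists_separating_refinement[where V = V]) (fact assms)+
  then obtain W1 g h where W1: "\<forall>i\<in>I. openin X (W1 i) \<and> W1 i \<noteq> {} \<and> W1 i \<subseteq> W i \<and> g i \<in> G \<and> h i \<in> G \<and>
      separates \<epsilon> \<eta> W1 I i (g i) (h i)"
    by (elim exE)
  have "\<exists>W'. openin X W' \<and> W' \<noteq> {} \<and> X closure_of W' \<subseteq> W1 i \<and> (\<exists>U\<in>\<U> n. X closure_of W' \<subseteq> U)"
    if "i \<in> I" for i
  proof -
    have "openin X (W1 i)" "W1 i \<noteq> {}" using bspec[OF W1 that] by simp_all
    from cover_complete_shrink[OF reg X this] show ?thesis by metis
  qed
  then have "\<forall>i\<in>I. \<exists>W'. openin X W' \<and> W' \<noteq> {} \<and> X closure_of W' \<subseteq> W1 i \<and> (\<exists>U\<in>\<U> n. X closure_of W' \<subseteq> U)"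
    by blast
  then obtain W' where W': "\<forall>i\<in>I. openin X (W' i) \<and> W' i \<noteq> {} \<and> X closure_of W' i \<subseteq> W1 i \<and>
      (\<exists>U\<in>\<U> n. X closure_of W' i \<subseteq> U)"
    unfolding bchoice_iff by blast
  have "separates \<epsilon> \<eta> (\<lambda>j. X closure_of W' j) I i (g i) (h i)" if "i \<in> I" for i
    by (rule separates_mono[of _ _ W1]) (use that W1 W' in auto)
  moreover have "X closure_of W' i \<subseteq> W i" if "i \<in> I" for i
    using bspec[OF W1 that] bspec[OF W' that] by (meson order_trans)
  ultimately show ?thesis
    using W1 W' by (intro exI[of _ W'] exI[of _ g] exI[of _ h]) auto
qed

lemma exists_separating_scheme:
  assumes reg: "regular_space X" and X: "cover_complete X \<U>"
    and cont: "\<And>g. g \<in> G \<Longrightarrow> continuous_map X mtopology g"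
    and tb: "\<And>x. x \<in> topspace X \<Longrightarrow> mtotally_bounded ((\<lambda>g. g x) ` G)"
    and nae: "\<not> almost_equicontinuous X d G"
  shows "\<exists>\<epsilon> C g h. separating_scheme M d X \<U> G \<epsilon> C g h"
proof -
  obtain \<epsilon>' V where "0 < \<epsilon>'" and V: "openin X V" "V \<noteq> {}"
    and osc': "\<And>W. \<lbrakk>openin X W; W \<noteq> {}; W \<subseteq> V\<rbrakk> \<Longrightarrow> \<exists>g\<in>G. \<exists>x\<in>W. \<exists>y\<in>W. d (g x) (g y) > \<epsilon>'"
    using not_almost_equicontinuous_imp_oscillation[OF reg X nae] by metis
  \<comment> \<open>Finding a pair that is \<open>\<epsilon>\<close>-apart takes oscillation above
    \<open>3 * \<epsilon>\<close>.\<close>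
  define \<epsilon> where "\<epsilon> = \<epsilon>' / 3"
  have "0 < \<epsilon>" using \<open>0 < \<epsilon>'\<close> by (simp add: \<epsilon>_def)
  have osc: "\<exists>g\<in>G. \<exists>x\<in>W. \<exists>y\<in>W. d (g x) (g y) > 3 * \<epsilon>" if "openin X W" "W \<noteq> {}" "W \<subseteq> V" for W
    using osc'[OF that] by (simp add: \<epsilon>_def)
  \<comment> \<open>Stage \<open>n\<close> handles the words of length \<open>n + 1\<close>, in step
    with \<open>\<U> n\<close>; the empty word is added at the end.\<close>
  define L where "L n = {s :: bool list. length s = Suc n}" for n
  have finL: "finite (L n)" for n
    using finite_lists_length_eq[of "UNIV :: bool set" "Suc n"] by (simp add: L_def)
  \<comment> \<open>A stage is a triple of functions on all words, constrained only on
    \<open>L n\<close>. The denominator is the word length plus one, as in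
    \<open>near\<close>.\<close>
  define good where "good n p \<longleftrightarrow> (case p of (W, g, h) \<Rightarrow>
      \<forall>s\<in>L n. openin X (W s) \<and> W s \<noteq> {} \<and> W s \<subseteq> V \<and> (\<exists>U\<in>\<U> n. X closure_of W s \<subseteq> U) \<and>
        g s \<in> G \<and> h s \<in> G \<and>
        separates \<epsilon> (\<epsilon> / real (Suc (Suc n))) (\<lambda>t. X closure_of W t) (L n) s (g s) (h s))" for n p
  have step: "\<exists>p. good n p \<and> (\<forall>s\<in>L n. X closure_of fst p s \<subseteq> W s)"
    if W: "\<And>s. s \<in> L n \<Longrightarrow> openin X (W s) \<and> W s \<noteq> {} \<and> W s \<subseteq> V" for n W
  proof -
    have eta: "0 < \<epsilon> / real (Suc (Suc n))" using \<open>0 < \<epsilon>\<close> by simp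
    have "\<exists>W' g h. \<forall>i\<in>L n. openin X (W' i) \<and> W' i \<noteq> {} \<and> X closure_of W' i \<subseteq> W i \<and>
           (\<exists>U\<in>\<U> n. X closure_of W' i \<subseteq> U) \<and> g i \<in> G \<and> h i \<in> G \<and>
           separates \<epsilon> (\<epsilon> / real (Suc (Suc n))) (\<lambda>j. X closure_of W' j) (L n) i (g i) (h i)"
      by (rule exists_closed_separating_refinement[where V = V])
        (fact reg X cont tb \<open>0 < \<epsilon>\<close> eta osc finL W)+
    then obtain W' g h where W': "\<forall>i\<in>L n. openin X (W' i) \<and> W' i \<noteq> {} \<and> X closure_of W' i \<subseteq> W i \<and>
           (\<exists>U\<in>\<U> n. X closure_of W' i \<subseteq> U) \<and> g i \<in> G \<and> h i \<in> G \<and>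
           separates \<epsilon> (\<epsilon> / real (Suc (Suc n))) (\<lambda>j. X closure_of W' j) (L n) i (g i) (h i)"
      by (elim exE)
    have "W' s \<subseteq> V" if "s \<in> L n" for s
      using bspec[OF W' that] W[OF that] openin_subset_closure_of[of X "W' s"] by (meson order_trans)
    with W' show ?thesis
      by (intro exI[of _ "(W', g, h)"]) (simp add: good_def)
  qed
  \<comment> \<open>Both children start from the set of their parent \<open>butlast s\<close>; the
    refinement then separates them.\<close>
  have "\<exists>p. \<forall>n. good n (p n) \<and> (\<forall>s\<in>L (Suc n). X closure_of fst (p (Suc n)) s \<subseteq> fst (p n) (butlast s))"
  proof (rule dependent_nat_choice)
    show "\<exists>p. good 0 p"
      using step[of 0 "\<lambda>_. V"] V by blast
    show "\<exists>q. good (Suc n) q \<and> (\<forall>s\<in>L (Suc n). X closure_of fst q s \<subseteq> fst p (butlast s))"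
      if "good n p" for p n
    proof (rule step)
      fix s assume "s \<in> L (Suc n)"
      then have "butlast s \<in> L n" by (simp add: L_def)
      with that show "openin X (fst p (butlast s)) \<and> fst p (butlast s) \<noteq> {} \<and> fst p (butlast s) \<subseteq> V"
        by (auto simp: good_def split: prod.splits)
    qed
  qed
  then obtain p where good: "\<And>n. good n (p n)"
    and p: "\<And>n s. s \<in> L (Suc n) \<Longrightarrow> X closure_of fst (p (Suc n)) s \<subseteq> fst (p n) (butlast s)" by blast
  define W where "W s = fst (p (length s - 1)) s" for s
  define g where "g s = fst (snd (p (length s - 1))) s" for s
  define h where "h s = snd (snd (p (length s - 1))) s" for s
  have scheme: "openin X (W s)" "W s \<noteq> {}" "\<exists>U\<in>\<U> n. X closure_of W s \<subseteq> U" "g s \<in> G" "h s \<in> G"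
    "separates \<epsilon> (\<epsilon> / real (Suc (Suc n))) (\<lambda>t. X closure_of W t) (L n) s (g s) (h s)"
    if "length s = Suc n" for s n
  proof -
    have "separates \<epsilon> (\<epsilon> / real (Suc (Suc n))) (\<lambda>t. X closure_of W t) (L n) s (g s) (h s) \<longleftrightarrow>
      separates \<epsilon> (\<epsilon> / real (Suc (Suc n))) (\<lambda>t. X closure_of fst (p n) t) (L n) s (g s) (h s)"
      using that by (auto simp: separates_def L_def W_def)
    then show "openin X (W s)" "W s \<noteq> {}" "\<exists>U\<in>\<U> n. X closure_of W s \<subseteq> U" "g s \<in> G" "h s \<in> G"
      "separates \<epsilon> (\<epsilon> / real (Suc (Suc n))) (\<lambda>t. X closure_of W t) (L n) s (g s) (h s)"
      using good[of n] that
      by (auto simp: good_def W_def g_def h_def L_def split: prod.splits)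
  qed
  \<comment> \<open>For the empty word \<open>length s - 1\<close> is \<open>0\<close>, and stage
    \<open>0\<close> says nothing about that word; hence the separate value.\<close>
  define C where "C s = (if s = [] then topspace X else X closure_of W s)" for s
  have "separating_scheme M d X \<U> G \<epsilon> C g h"
  proof
    show "closedin X (C s)" for s by (simp add: C_def)
    show "C s \<noteq> {}" for s
    proof (cases "s = []")
      case True
      then show ?thesis using V openin_subset by (auto simp: C_def)
    next
      case False
      then have "length s = Suc (length s - 1)" by simp
      from scheme(1,2)[OF this] show ?thesis
        using False openin_subset_closure_of[of X "W s"] by (auto simp: C_def)
    qed
    show "C (s @ [b]) \<subseteq> C s" for s b
    proof (cases "s = []")
      case True
      then show ?thesis by (simp add: C_def closure_of_subset_topspace)
    next
      case False
      then obtain n where n: "length s = Suc n" by (metis length_0_conv not0_implies_Suc)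
      have "X closure_of W (s @ [b]) \<subseteq> W s"
        using p[of "s @ [b]" n] n by (simp add: W_def L_def)
      also have "\<dots> \<subseteq> X closure_of W s"
        using scheme(1)[OF n] by (rule openin_subset_closure_of)
      finally show ?thesis using False by (simp add: C_def)
    qed
    show "\<exists>U\<in>\<U> n. C s \<subseteq> U" if "length s = Suc n" for s n
      using scheme(3)[OF that] that by (auto simp: C_def)
    fix s :: "bool list" assume "s \<noteq> []"
    then obtain n where n: "length s = Suc n" by (metis length_0_conv not0_implies_Suc)
    show "g s \<in> G" "h s \<in> G" using scheme(4,5)[OF n] by auto
    show "\<epsilon> < d (g s x) (h s x)" if "x \<in> C s" for x
      using scheme(6)[OF n] that \<open>s \<noteq> []\<close> by (simp add: separates_def C_def)
    show "d (g s x) (h s x) < \<epsilon> / real (Suc (length s))" if "length t = length s" "t \<noteq> s" "x \<in> C t" for t x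
    proof -
      have "t \<in> L n - {s}" "x \<in> X closure_of W t"
        using that n by (auto simp: L_def C_def split: if_splits)
      then have "d (g s x) (h s x) < \<epsilon> / real (Suc (Suc n))"
        using scheme(6)[OF n] unfolding separates_def by blast
      then show ?thesis using n by simp
    qed
  qed (use X \<open>0 < \<epsilon>\<close> in auto)
  then show ?thesis by blast
qed

end

section \<open>Levels, branches and the compact kernel of a scheme\<close>

context separating_scheme
begin

definition level :: "nat \<Rightarrow> 'b set" where
  "level n = (\<Union>s\<in>{s. length s = n}. C s)"

text \<open>The index starts at 1 to match \<open>C_small\<close>; as the levels decrease, the
  intersection is that of all levels.\<close>

definition core :: "'b set" where
  "core = (\<Inter>n. level (Suc n))"

definition stem :: "(nat \<Rightarrow> bool) \<Rightarrow> nat \<Rightarrow> bool list" where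
  "stem \<sigma> n = map \<sigma> [0..<n]"

definition fibre :: "(nat \<Rightarrow> bool) \<Rightarrow> 'b set" where
  "fibre \<sigma> = (\<Inter>n. C (stem \<sigma> n))"

lemma length_stem [simp]: "length (stem \<sigma> n) = n"
  by (simp add: stem_def)

lemma stem_Suc_neq_Nil [simp]: "stem \<sigma> (Suc n) \<noteq> []"
  by (simp add: stem_def)

lemma stem_Suc: "stem \<sigma> (Suc n) = stem \<sigma> n @ [\<sigma> n]"
  by (simp add: stem_def)

lemma C_sub_topspace: "C s \<subseteq> topspace X"
  by (rule closedin_subset[OF C_closed])

lemma finite_words: "finite {s :: bool list. length s = n}"
  using finite_lists_length_eq[of "UNIV :: bool set" n] by simp

text \<open>The pair of \<open>s\<close> tells the two sets apart: its distance exceeds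
  \<open>\<epsilon>\<close> on \<open>C s\<close> and is below \<open>\<epsilon>\<close> on
  \<open>C t\<close>.\<close>

lemma C_disjoint:
  assumes "length s = length t" "s \<noteq> t"
  shows "C s \<inter> C t = {}"
proof (rule ccontr)
  assume "C s \<inter> C t \<noteq> {}"
  then obtain x where x: "x \<in> C s" "x \<in> C t" by blast
  have s: "s \<noteq> []" using assms by auto
  have "d (g s x) (h s x) < \<epsilon> / real (Suc (length s))"
    using near[OF s _ _ x(2)] assms by auto
  also have "\<dots> \<le> \<epsilon>"
    using eps_pos by (simp add: field_simps)
  finally show False using far[OF s x(1)] by simp
qed

lemma closedin_level: "closedin X (level n)"
  unfolding level_def by (intro closedin_Union finite_imageI finite_words) (auto simp: C_closed)

lemma level_Suc: "level (Suc n) \<subseteq> level n"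
proof
  fix x assume "x \<in> level (Suc n)"
  then obtain s where s: "length s = Suc n" "x \<in> C s" by (auto simp: level_def)
  then have "s = butlast s @ [last s]" by (metis append_butlast_last_id length_0_conv nat.simps(3))
  then have "x \<in> C (butlast s)" using C_append[of "butlast s" "last s"] s(2) by auto
  then show "x \<in> level n" using s(1) by (auto simp: level_def intro!: exI[of _ "butlast s"])
qed

text \<open>A level consists of finitely many small sets, so finitely many members of
  \<open>\<U> n\<close> cover it and completeness applies.\<close>

lemma compactin_core: "compactin X core"
  unfolding core_def
proof (rule cover_complete_nest(1)[OF complete])
  show "closedin X (level (Suc n))" for n by (rule closedin_level)
  show "level (Suc n) \<noteq> {}" for n
    using C_nonempty[of "replicate (Suc n) False"] by (force simp: level_def)
  show "level (Suc (Suc n)) \<subseteq> level (Suc n)" for n by (rule level_Suc)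
  show "\<exists>\<V>. finite \<V> \<and> \<V> \<subseteq> \<U> n \<and> level (Suc n) \<subseteq> \<Union>\<V>" for n
  proof -
    have "\<forall>s\<in>{s. length s = Suc n}. \<exists>U. U \<in> \<U> n \<and> C s \<subseteq> U" using C_small by blast
    then obtain U where U: "\<forall>s\<in>{s. length s = Suc n}. U s \<in> \<U> n \<and> C s \<subseteq> U s"
      unfolding bchoice_iff by blast
    then show ?thesis
      by (intro exI[of _ "U ` {s. length s = Suc n}"]) (auto simp: finite_words level_def)
  qed
qed

text \<open>Along a branch the traces of \<open>F\<close> decrease and are small for the covers, so
  completeness gives a common point.\<close>

lemma fibre_meets:
  assumes F: "closedin X F" and meets: "\<And>s. F \<inter> C s \<noteq> {}"
  shows "F \<inter> fibre \<sigma> \<noteq> {}"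
proof -
  have "(\<Inter>n. F \<inter> C (stem \<sigma> (Suc n))) \<noteq> {}"
  proof (rule cover_complete_nest(2)[OF complete])
    show "closedin X (F \<inter> C (stem \<sigma> (Suc n)))" for n
      using F C_closed by blast
    show "F \<inter> C (stem \<sigma> (Suc n)) \<noteq> {}" for n by (rule meets)
    show "F \<inter> C (stem \<sigma> (Suc (Suc n))) \<subseteq> F \<inter> C (stem \<sigma> (Suc n))" for n
      using C_append[of "stem \<sigma> (Suc n)" "\<sigma> (Suc n)"] unfolding stem_Suc[of \<sigma> "Suc n"] by blast
    show "\<exists>\<V>. finite \<V> \<and> \<V> \<subseteq> \<U> n \<and> F \<inter> C (stem \<sigma> (Suc n)) \<subseteq> \<Union>\<V>" for n
    proof -
      obtain U where "U \<in> \<U> n" "C (stem \<sigma> (Suc n)) \<subseteq> U" using C_small[of "stem \<sigma> (Suc n)" n] by auto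
      then show ?thesis by (intro exI[of _ "{U}"]) auto
    qed
  qed
  then obtain x where x: "x \<in> (\<Inter>n. F \<inter> C (stem \<sigma> (Suc n)))" by blast
  \<comment> \<open>The intersection above omits the empty stem; nesting supplies it.\<close>
  have "x \<in> C (stem \<sigma> n)" for n
    using x C_append[of "stem \<sigma> n" "\<sigma> n"] unfolding stem_Suc[symmetric] by blast
  with x show ?thesis by (auto simp: fibre_def)
qed

lemma fibre_sub_core: "fibre \<sigma> \<subseteq> core"
proof
  fix x assume "x \<in> fibre \<sigma>"
  then have "x \<in> C (stem \<sigma> (Suc n))" for n by (simp add: fibre_def)
  then show "x \<in> core" unfolding core_def level_def by (intro INT_I UN_I[of "stem \<sigma> (Suc n)" for n]) auto
qed

lemma core_meets: "core \<inter> C s \<noteq> {}"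
proof -
  \<comment> \<open>The word \<open>s\<close> is prolonged by \<open>False\<close> to a branch,
    whose fibre is nonempty and lies in both sets.\<close>
  define \<sigma> where "\<sigma> i = (if i < length s then s ! i else False)" for i
  have s: "stem \<sigma> (length s) = s"
    by (rule nth_equalityI) (simp_all add: stem_def \<sigma>_def)
  have "topspace X \<inter> fibre \<sigma> \<noteq> {}"
    using C_nonempty C_sub_topspace by (intro fibre_meets) (auto simp: Int_absorb1)
  moreover have "fibre \<sigma> \<subseteq> C (stem \<sigma> (length s))" by (auto simp: fibre_def)
  ultimately show ?thesis using fibre_sub_core[of \<sigma>] s by auto
qed

lemma fibres_disjoint:
  assumes "x \<in> fibre \<sigma>" "x \<in> fibre \<tau>"
  shows "\<sigma> = \<tau>"
proof
  fix n
  have "x \<in> C (stem \<sigma> (Suc n)) \<inter> C (stem \<tau> (Suc n))" using assms by (auto simp: fibre_def)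
  then have "stem \<sigma> (Suc n) = stem \<tau> (Suc n)" using C_disjoint[of "stem \<sigma> (Suc n)" "stem \<tau> (Suc n)"] by auto
  then show "\<sigma> n = \<tau> n" by (simp add: stem_Suc)
qed

text \<open>On each level exactly one word has \<open>x\<close> in its set, by disjointness. These
  words extend one another and so spell a branch.\<close>

lemma core_fibre:
  assumes "x \<in> core"
  shows "\<exists>\<sigma>. x \<in> fibre \<sigma>"
proof -
  have "x \<in> level (Suc n)" for n using assms by (simp add: core_def)
  then have "x \<in> level n" for n using level_Suc by blast
  then have "\<forall>n. \<exists>s. length s = n \<and> x \<in> C s" by (auto simp: level_def)
  then obtain w where w: "\<And>n. length (w n) = n" "\<And>n. x \<in> C (w n)" by metis
  define \<sigma> where "\<sigma> n = last (w (Suc n))" for n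
  have "stem \<sigma> n = w n" for n
  proof (induction n)
    case 0
    then show ?case using w(1)[of 0] by (simp add: stem_def)
  next
    case (Suc n)
    have "w (Suc n) \<noteq> []" using w(1)[of "Suc n"] by auto
    then have eq: "w (Suc n) = butlast (w (Suc n)) @ [\<sigma> n]" by (simp add: \<sigma>_def)
    then have "x \<in> C (butlast (w (Suc n)))"
      using C_append[of "butlast (w (Suc n))" "\<sigma> n"] w(2)[of "Suc n"] by auto
    then have "butlast (w (Suc n)) = w n"
      using C_disjoint[of "butlast (w (Suc n))" "w n"] w(1)[of "Suc n"] w(1)[of n] w(2)[of n] by auto
    with eq show ?case using Suc.IH by (simp add: stem_Suc)
  qed
  then show ?thesis using w(2) by (auto simp: fibre_def intro!: exI[of _ \<sigma>])
qed

text \<open>By Zorn's lemma, as \<open>core\<close> is compact. The last property makes the countably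
  many sets \<open>F \<inter> C s\<close> a \<open>\<pi>\<close>-base of \<open>F\<close>, which yields separability.\<close>

lemma exists_minimal:
  obtains F where "closedin X F" "F \<subseteq> core" "compactin X F" "\<And>s. F \<inter> C s \<noteq> {}"
    "\<And>V. \<lbrakk>openin X V; V \<inter> F \<noteq> {}\<rbrakk> \<Longrightarrow> \<exists>s. F \<inter> C s \<subseteq> V"
proof -
  \<comment> \<open>Zorn's lemma is applied to open complements: a maximal \<open>V\<close> gives a
    minimal closed set \<open>core - V\<close> meeting every \<open>C s\<close>.\<close>
  define \<A> where "\<A> = {V. openin X V \<and> (\<forall>s. (core - V) \<inter> C s \<noteq> {})}"
  have "\<exists>V\<in>\<A>. \<forall>W\<in>\<A>. V \<subseteq> W \<longrightarrow> W = V"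
  proof (rule subset_Zorn_nonempty)
    show "\<A> \<noteq> {}" using core_meets by (auto simp: \<A>_def intro!: exI[of _ "{}"])
    fix \<C> assume \<C>: "\<C> \<noteq> {}" "subset.chain \<A> \<C>"
    then have sub: "\<C> \<subseteq> \<A>" by (simp add: subset.chain_def)
    have "(core - \<Union>\<C>) \<inter> C s \<noteq> {}" for s
    proof
      assume "(core - \<Union>\<C>) \<inter> C s = {}"
      then have cov: "core \<inter> C s \<subseteq> \<Union>\<C>" by blast
      have "compactin X (core \<inter> C s)" using compactin_core C_closed by (rule compact_Int_closedin)
      moreover have "\<forall>V\<in>\<C>. openin X V" using sub by (auto simp: \<A>_def)
      ultimately obtain \<F> where \<F>: "finite \<F>" "\<F> \<subseteq> \<C>" "core \<inter> C s \<subseteq> \<Union>\<F>"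
        using cov unfolding compactin_def by meson
      \<comment> \<open>A finite nonempty subfamily of a chain contains its union, so a single
        member of \<open>\<A>\<close> would cover \<open>core \<inter> C s\<close>, which no member
        does.\<close>
      have "\<F> \<noteq> {}" using \<F>(3) core_meets[of s] by auto
      then have "\<Union>\<F> \<in> \<F>"
        using \<F>(1,2) \<C>(2) by (intro Union_in_chain[where \<A> = \<A>]) (auto simp: subset.chain_def subset_iff)
      then have "\<Union>\<F> \<in> \<A>" using \<F>(2) sub by blast
      then show False using \<F>(3) by (auto simp: \<A>_def)
    qed
    moreover have "openin X (\<Union>\<C>)" using sub by (auto simp: \<A>_def)
    ultimately show "\<Union>\<C> \<in> \<A>" by (simp add: \<A>_def)
  qed
  then obtain V where V: "V \<in> \<A>" and max: "\<And>W. \<lbrakk>W \<in> \<A>; V \<subseteq> W\<rbrakk> \<Longrightarrow> W = V" by blast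
  have opV: "openin X V" using V by (simp add: \<A>_def)
  have clcore: "closedin X core"
    unfolding core_def using closedin_level by blast
  show thesis
  proof
    show cl: "closedin X (core - V)" using clcore opV by (rule closedin_diff)
    show "core - V \<subseteq> core" by blast
    show "compactin X (core - V)" by (rule closed_compactin[OF compactin_core _ cl]) blast
    show "(core - V) \<inter> C s \<noteq> {}" for s using V by (simp add: \<A>_def)
    fix W assume W: "openin X W" "W \<inter> (core - V) \<noteq> {}"
    then have "V \<union> W \<noteq> V" by blast
    \<comment> \<open>Enlarging the maximal \<open>V\<close> by \<open>W\<close> must break the
      condition at some \<open>s\<close>, so the trace of \<open>core - V\<close> on
      \<open>C s\<close> lies in \<open>W\<close>.\<close>
    then have "V \<union> W \<notin> \<A>" using max[of "V \<union> W"] by blast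
    then obtain s where "(core - (V \<union> W)) \<inter> C s = {}"
      using W opV by (auto simp: \<A>_def)
    then show "\<exists>s. (core - V) \<inter> C s \<subseteq> W" by blast
  qed
qed

text \<open>One point from each \<open>F \<inter> C s\<close> gives a dense set by
  \<open>minimal\<close>, and there are only countably many words.\<close>

lemma separable_minimal:
  assumes "F \<subseteq> topspace X" and meets: "\<And>s. F \<inter> C s \<noteq> {}"
    and minimal: "\<And>V. \<lbrakk>openin X V; V \<inter> F \<noteq> {}\<rbrakk> \<Longrightarrow> \<exists>s. F \<inter> C s \<subseteq> V"
  shows "separable_space (subtopology X F)"
proof -
  define c where "c s = (SOME x. x \<in> F \<inter> C s)" for s
  have c: "c s \<in> F \<inter> C s" for s
    using meets[of s] unfolding c_def by (metis some_in_eq)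
  have "subtopology X F closure_of range c = topspace (subtopology X F)"
  proof (intro subset_antisym subsetI)
    fix x assume "x \<in> topspace (subtopology X F)"
    then have x: "x \<in> F" by simp
    show "x \<in> subtopology X F closure_of range c"
      unfolding in_closure_of
    proof (intro conjI allI impI)
      show "x \<in> topspace (subtopology X F)" by fact
      fix T assume T: "x \<in> T \<and> openin (subtopology X F) T"
      then obtain V where V: "openin X V" "T = V \<inter> F" by (auto simp: openin_subtopology)
      then obtain s where "F \<inter> C s \<subseteq> V" using minimal[of V] x T by blast
      then show "\<exists>y. y \<in> range c \<and> y \<in> T" using c[of s] V(2) by blast
    qed
  qed (auto simp: closure_of_def)
  moreover have "countable (range c)" by simp
  moreover have "range c \<subseteq> topspace (subtopology X F)" using c assms(1) by auto
  ultimately show ?thesis unfolding separable_space_def by blast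
qed

text \<open>A neighbourhood in \<open>F\<close> contains some \<open>F \<inter> C s\<close>, hence
  points \<open>y\<close> and \<open>z\<close> in the sets of both children of \<open>s\<close>. The
  pair of \<open>s @ [True]\<close> is far apart at \<open>y\<close> and close at \<open>z\<close>,
  so one of its functions oscillates.\<close>

lemma not_almost_equicontinuous_minimal:
  assumes "F \<noteq> {}" "F \<subseteq> topspace X" and meets: "\<And>s. F \<inter> C s \<noteq> {}"
    and minimal: "\<And>V. \<lbrakk>openin X V; V \<inter> F \<noteq> {}\<rbrakk> \<Longrightarrow> \<exists>s. F \<inter> C s \<subseteq> V"
    and maps: "\<And>k x. \<lbrakk>k \<in> G; x \<in> topspace X\<rbrakk> \<Longrightarrow> k x \<in> M"
  shows "\<not> almost_equicontinuous (subtopology X F) d G"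
proof -
  have "\<not> equicontinuity_point (subtopology X F) d G x" for x
  proof
    assume eq: "equicontinuity_point (subtopology X F) d G x"
    \<comment> \<open>If both functions oscillate by less than \<open>\<epsilon>/4\<close>, then,
      their distance at \<open>z\<close> being below \<open>\<epsilon>/2\<close>, their distance at
      \<open>y\<close> is below \<open>\<epsilon>\<close>.\<close>
    have "\<epsilon> / 4 > 0" using eps_pos by simp
    then obtain T where T: "openin (subtopology X F) T" "x \<in> T" "\<And>k. k \<in> G \<Longrightarrow> ediameter d (k ` T) < ennreal (\<epsilon>/4)"
      using eq unfolding equicontinuity_point_def by meson
    then obtain V where V: "openin X V" "T = V \<inter> F" by (auto simp: openin_subtopology)
    then obtain s where s: "F \<inter> C s \<subseteq> V" using minimal[of V] T(2) by blast
    obtain y z where y: "y \<in> F \<inter> C (s @ [True])" and z: "z \<in> F \<inter> C (s @ [False])"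
      using meets by blast
    define k l where "k = g (s @ [True])" and "l = h (s @ [True])"
    have kl: "k \<in> G" "l \<in> G" using g_in h_in by (simp_all add: k_def l_def)
    have yz: "y \<in> T" "z \<in> T" using y z s C_append[of s True] C_append[of s False] V(2) by auto
    have m: "k y \<in> M" "k z \<in> M" "l y \<in> M" "l z \<in> M"
      using maps kl y z assms(2) by auto
    have "d (k y) (k z) < \<epsilon>/4" "d (l z) (l y) < \<epsilon>/4"
      using ediameter_less_imp[OF T(3)] kl yz by auto
    moreover have "d (k z) (l z) < \<epsilon> / real (Suc (length (s @ [True])))"
      unfolding k_def l_def using near[of "s @ [True]" "s @ [False]" z] z by simp
    moreover have "\<epsilon> / real (Suc (length (s @ [True]))) \<le> \<epsilon> / 2"
      using eps_pos by (intro divide_left_mono) auto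
    moreover have "\<epsilon> < d (k y) (l y)"
      unfolding k_def l_def using far[of "s @ [True]" y] y by simp
    moreover have "d (k y) (l y) \<le> d (k y) (k z) + d (k z) (l z) + d (l z) (l y)"
      using triangle[OF m(1,2,3)] triangle[OF m(2,4,3)] by linarith
    ultimately show False by linarith
  qed
  then have no_points: "{x. equicontinuity_point (subtopology X F) d G x} = {}" by blast
  show ?thesis
    unfolding almost_equicontinuous_def no_points using assms(1,2) by (simp add: Int_absorb1)
qed

text \<open>\<open>(u, v)\<close> is a cluster point of the pairs \<open>(g s, h s)\<close> along the branch \<open>\<sigma>\<close>.\<close>

lemma exists_limit_pair:
  assumes cpt: "compactin (product_topology (\<lambda>_. mtopology) S) H" and "G \<subseteq> H" and "core \<subseteq> S"
  shows "\<exists>u\<in>H. \<exists>v\<in>H. (\<forall>x\<in>fibre \<sigma>. \<epsilon> \<le> d (u x) (v x)) \<and> (\<forall>x\<in>core - fibre \<sigma>. u x = v x)"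
proof -
  let ?P = "product_topology (\<lambda>_. mtopology) S"
  \<comment> \<open>Compactness is applied to pairs, so that \<open>u\<close> and \<open>v\<close>
    are approximated by \<open>g\<close> and \<open>h\<close> at the same words.\<close>
  define Z where "Z = prod_topology (subtopology ?P H) (subtopology ?P H)"
  have HP: "H \<subseteq> topspace ?P" using cpt by (rule compactin_subset_topspace)
  have topZ: "topspace Z = H \<times> H" using HP by (simp add: Z_def Int_absorb1)
  have Z: "compact_space Z"
    using cpt by (simp add: Z_def compact_space_prod_topology compact_space_subtopology)
  have val: "continuous_map Z mtopology (\<lambda>q. fst q x)" "continuous_map Z mtopology (\<lambda>q. snd q x)" if "x \<in> S" for x
  proof -
    have proj: "continuous_map (subtopology ?P H) mtopology (\<lambda>k. k x)"
      using that by (intro continuous_map_from_subtopology continuous_map_product_projection)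
    show "continuous_map Z mtopology (\<lambda>q. fst q x)" "continuous_map Z mtopology (\<lambda>q. snd q x)"
      using continuous_map_compose[OF continuous_map_fst proj] continuous_map_compose[OF continuous_map_snd proj]
      by (simp_all add: Z_def comp_def)
  qed
  define p where "p m = (g (stem \<sigma> (Suc m)), h (stem \<sigma> (Suc m)))" for m
  have pZ: "p m \<in> topspace Z" for m
    using g_in[of "stem \<sigma> (Suc m)"] h_in[of "stem \<sigma> (Suc m)"] \<open>G \<subseteq> H\<close>
    by (auto simp: topZ p_def)
  \<comment> \<open>A point in the closures of all tails is a cluster point of \<open>p\<close>,
    which need not have a convergent subsequence.\<close>
  have "(\<Inter>n. Z closure_of (p ` {n..})) \<noteq> {}"
  proof (rule compact_space_imp_nest[OF Z])
    show "Z closure_of (p ` {n..}) \<noteq> {}" for n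
      using closure_of_subset[of "p ` {n..}" Z] pZ by fastforce
    show "decseq (\<lambda>n. Z closure_of (p ` {n..}))"
      by (auto simp: decseq_def intro!: closure_of_mono image_mono)
  qed simp
  then obtain q where q: "q \<in> (\<Inter>n. Z closure_of (p ` {n..}))" by blast
  obtain u v where uv: "q = (u, v)" by (cases q)
  have qcl: "(u, v) \<in> Z closure_of (p ` {n..})" for n using q uv by blast
  have uvH: "u \<in> H" "v \<in> H"
    using qcl[of 0] closure_of_subset_topspace[of Z] topZ by auto
  have approx: "\<exists>m\<ge>n. p m \<in> T" if "openin Z T" "(u, v) \<in> T" for n T
    using qcl[of n] that unfolding in_closure_of by blast
  have "\<epsilon> \<le> d (u x) (v x)" if x: "x \<in> fibre \<sigma>" for x
  proof (rule ccontr)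
    assume less: "\<not> \<epsilon> \<le> d (u x) (v x)"
    have "x \<in> S" using x fibre_sub_core \<open>core \<subseteq> S\<close> by blast
    then obtain m where "d (fst (p m) x) (snd (p m) x) < \<epsilon>"
      using approx[OF openin_mdist(1)[OF val], of x x \<epsilon> 0] less uvH topZ by auto
    moreover have "\<epsilon> < d (fst (p m) x) (snd (p m) x)"
      using x far[of "stem \<sigma> (Suc m)" x] by (simp add: p_def fibre_def)
    ultimately show False by simp
  qed
  moreover have "u x = v x" if x: "x \<in> core - fibre \<sigma>" for x
  proof (rule ccontr)
    assume "u x \<noteq> v x"
    have "x \<in> S" using x \<open>core \<subseteq> S\<close> by blast
    then have "u x \<in> M" "v x \<in> M" using uvH HP by (auto simp: PiE_iff)
    then have pos: "d (u x) (v x) / 2 > 0" using \<open>u x \<noteq> v x\<close> by simp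
    obtain \<tau> where \<tau>: "x \<in> fibre \<tau>" using core_fibre x by blast
    then have "\<tau> \<noteq> \<sigma>" using x by auto
    then obtain j where j: "\<tau> j \<noteq> \<sigma> j" by auto
    \<comment> \<open>This makes \<open>\<epsilon> / Suc n\<close> smaller than half the distance of
      \<open>u x\<close> and \<open>v x\<close>. Taking \<open>m\<close> beyond \<open>j\<close> as
      well makes the stems of \<open>\<tau>\<close> and \<open>\<sigma>\<close> differ, so that
      \<open>near\<close> applies.\<close>
    obtain n where n: "inverse (real (Suc n)) < d (u x) (v x) / 2 / \<epsilon>"
      using reals_Archimedean[of "d (u x) (v x) / 2 / \<epsilon>"] pos eps_pos by auto
    obtain m where m: "m \<ge> max n j" "d (fst (p m) x) (snd (p m) x) > d (u x) (v x) / 2"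
      using approx[OF openin_mdist(2)[OF val], of x x "d (u x) (v x) / 2" "max n j"] pos \<open>x \<in> S\<close> uvH topZ
      by auto
    have "stem \<tau> (Suc m) ! j \<noteq> stem \<sigma> (Suc m) ! j" using j m(1) by (simp add: stem_def del: upt_Suc)
    then have "stem \<tau> (Suc m) \<noteq> stem \<sigma> (Suc m)" by metis
    moreover have "x \<in> C (stem \<tau> (Suc m))" using \<tau> by (simp add: fibre_def)
    ultimately have "d (fst (p m) x) (snd (p m) x) < \<epsilon> / real (Suc (Suc m))"
      using near[of "stem \<sigma> (Suc m)" "stem \<tau> (Suc m)" x] by (simp add: p_def)
    also have "\<dots> \<le> \<epsilon> / real (Suc n)"
      using eps_pos m(1) by (intro divide_left_mono) auto
    also have "\<dots> < d (u x) (v x) / 2"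
      using n eps_pos by (simp add: field_simps)
    finally show False using m(2) by simp
  qed
  ultimately show ?thesis using uvH by blast
qed

section \<open>Failure of the Lindelof property in the weak topology\<close>

lemma topspace_weak_topology: "topspace (weak_topology F Y K) = F"
  by (auto simp: weak_topology_def)

lemma openin_weak_topology:
  assumes "k \<in> K" "openin Y U"
  shows "openin (weak_topology F Y (restrict_functions K F)) {x \<in> F. k x \<in> U}"
proof -
  have eq: "{x \<in> F. k x \<in> U} = restrict k F -` U \<inter> F" by auto
  have "restrict k F \<in> restrict_functions K F" using assms(1) by (simp add: restrict_functions_def)
  then show ?thesis
    unfolding weak_topology_def eq using assms(2) by (intro topology_generated_by_Basis) blast
qed

text \<open>Points of \<open>F\<close> have weak neighbourhoods inside a single fibre. As
  \<open>F\<close> meets every fibre and fibres are disjoint, a countable subcover by such sets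
  would enumerate all branches.\<close>

lemma not_Lindelof_weak_topology:
  assumes cpt: "compactin (product_topology (\<lambda>_. mtopology) S) H" and "G \<subseteq> H" and "core \<subseteq> S"
    and F: "closedin X F" "F \<subseteq> core" and meets: "\<And>s. F \<inter> C s \<noteq> {}"
  shows "\<not> Lindelof_space (weak_topology F mtopology (restrict_functions H F))"
proof
  let ?T = "weak_topology F mtopology (restrict_functions H F)"
  assume L: "Lindelof_space ?T"
  define \<N> where "\<N> = {N. openin ?T N \<and> (\<exists>\<sigma>. N \<subseteq> fibre \<sigma>)}"
  have HP: "H \<subseteq> topspace (product_topology (\<lambda>_. mtopology) S)"
    using cpt by (rule compactin_subset_topspace)
  have HM: "k x \<in> M" if "k \<in> H" "x \<in> F" for k x
    using that HP F(2) \<open>core \<subseteq> S\<close> by (auto simp: PiE_iff)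
  have "\<exists>N\<in>\<N>. x \<in> N" if x: "x \<in> F" for x
  proof -
    obtain \<sigma> where \<sigma>: "x \<in> fibre \<sigma>" using core_fibre x F(2) by blast
    obtain u v where uv: "u \<in> H" "v \<in> H" "\<And>x. x \<in> fibre \<sigma> \<Longrightarrow> \<epsilon> \<le> d (u x) (v x)"
      "\<And>x. x \<in> core - fibre \<sigma> \<Longrightarrow> u x = v x"
      using exists_limit_pair[OF cpt \<open>G \<subseteq> H\<close> \<open>core \<subseteq> S\<close>, of \<sigma>] by blast
    \<comment> \<open>Off the fibre \<open>u\<close> and \<open>v\<close> agree, so a point of
      \<open>N\<close> there would force \<open>d (u x) (v x) < \<epsilon>\<close>.\<close>
    define N where "N = {y \<in> F. u y \<in> mball (u x) (\<epsilon>/2)} \<inter> {y \<in> F. v y \<in> mball (v x) (\<epsilon>/2)}"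
    have "openin ?T N"
      unfolding N_def using uv by (intro openin_Int openin_weak_topology) auto
    moreover have "N \<subseteq> fibre \<sigma>"
    proof
      fix y assume y: "y \<in> N"
      show "y \<in> fibre \<sigma>"
      proof (rule ccontr)
        assume "y \<notin> fibre \<sigma>"
        then have "u y = v y" using uv(4)[of y] y F(2) by (auto simp: N_def)
        moreover have "d (u x) (u y) < \<epsilon>/2" "d (v x) (v y) < \<epsilon>/2" using y by (auto simp: N_def in_mball)
        moreover have "d (u x) (v x) \<le> d (u x) (u y) + d (v x) (u y)"
          using triangle'[of "u x" "u y" "v x"] HM uv(1,2) x y by (auto simp: N_def)
        ultimately show False using uv(3)[OF \<sigma>] by simp
      qed
    qed
    moreover have "x \<in> N" using x HM uv(1,2) eps_pos by (simp add: N_def)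
    ultimately show ?thesis by (auto simp: \<N>_def)
  qed
  then have "F \<subseteq> \<Union>\<N>" by blast
  moreover have "\<Union>\<N> \<subseteq> F"
    using openin_subset[of ?T] unfolding \<N>_def topspace_weak_topology by blast
  ultimately have covers: "\<Union>\<N> = topspace ?T" unfolding topspace_weak_topology by blast
  have opens: "\<forall>N\<in>\<N>. openin ?T N" by (simp add: \<N>_def)
  obtain \<V> where \<V>: "countable \<V>" "\<V> \<subseteq> \<N>" "\<Union>\<V> = F"
    using mp[OF spec[OF L[unfolded Lindelof_space_def]] conjI[OF opens covers]]
    unfolding topspace_weak_topology by blast
  \<comment> \<open>A nonempty \<open>N\<close> lies in one fibre only, so \<open>SOME\<close>
    recovers every branch from a member of \<open>\<V>\<close>.\<close>
  have "\<exists>N\<in>\<V>. \<sigma> = (SOME \<tau>. N \<subseteq> fibre \<tau>)" for \<sigma>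
  proof -
    obtain y where y: "y \<in> F" "y \<in> fibre \<sigma>" using fibre_meets[OF F(1) meets, of \<sigma>] by blast
    then obtain N where N: "N \<in> \<V>" "y \<in> N" using \<V>(3) by blast
    then have "\<exists>\<tau>. N \<subseteq> fibre \<tau>" using \<V>(2) by (auto simp: \<N>_def)
    then have "N \<subseteq> fibre (SOME \<tau>. N \<subseteq> fibre \<tau>)" by (rule someI_ex)
    then have "\<sigma> = (SOME \<tau>. N \<subseteq> fibre \<tau>)" using fibres_disjoint y(2) N(2) by blast
    then show ?thesis using N(1) by blast
  qed
  then have "(UNIV :: (nat \<Rightarrow> bool) set) \<subseteq> (\<lambda>N. SOME \<tau>. N \<subseteq> fibre \<tau>) ` \<V>" by blast
  then have "countable (UNIV :: (nat \<Rightarrow> bool) set)"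
    using \<V>(1) countable_image countable_subset by blast
  \<comment> \<open>Cantor's diagonal argument: a list of all branches cannot contain the one that
    differs from the \<open>i\<close>-th branch at \<open>i\<close>.\<close>
  then have "range (from_nat_into (UNIV :: (nat \<Rightarrow> bool) set)) = UNIV"
    by (intro range_from_nat_into) auto
  then obtain n where "from_nat_into UNIV n = (\<lambda>i. \<not> from_nat_into (UNIV :: (nat \<Rightarrow> bool) set) i i)"
    by (metis UNIV_I image_iff)
  then show False by (metis)
qed

end

section \<open>The characterization\<close>

text \<open>Neighbourhoods in the subspace lie inside \<open>A\<close>, where a function and its
  restriction have the same images; this removes the restrictions from what follows.\<close>

lemma almost_equicontinuous_restrict_functions:
  "almost_equicontinuous (subtopology X A) d (restrict_functions G A) \<longleftrightarrow>
   almost_equicontinuous (subtopology X A) d G"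
proof -
  have image: "restrict k A ` U = k ` U" if "openin (subtopology X A) U" for k :: "'a \<Rightarrow> 'b" and U
    using openin_subset[OF that] by (intro image_cong) auto
  have small: "(\<forall>k\<in>restrict_functions G A. ediameter d (k ` U) < e) \<longleftrightarrow> (\<forall>k\<in>G. ediameter d (k ` U) < e)"
    if "openin (subtopology X A) U" for U e
    unfolding restrict_functions_def ball_simps by (simp only: image[OF that])
  have "equicontinuity_point (subtopology X A) d (restrict_functions G A) x \<longleftrightarrow>
      equicontinuity_point (subtopology X A) d G x" for x
    unfolding equicontinuity_point_def by (simp add: small cong: conj_cong)
  then show ?thesis by (simp add: almost_equicontinuous_def)
qed

lemma hereditarily_almost_equicontinuous_subtopology:
  assumes "closedin X F"
  shows "hereditarily_almost_equicontinuous (subtopology X F) d (restrict_functions G F) \<longleftrightarrow>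
    (\<forall>A. closedin X A \<and> A \<noteq> {} \<and> A \<subseteq> F \<longrightarrow> almost_equicontinuous (subtopology X A) d G)"
proof -
  have "almost_equicontinuous (subtopology (subtopology X F) A) d (restrict_functions (restrict_functions G F) A) \<longleftrightarrow>
      almost_equicontinuous (subtopology X A) d G" if "A \<subseteq> F" for A
  proof -
    have "restrict_functions (restrict_functions G F) A = restrict_functions G A"
      using that by (simp add: restrict_functions_def image_image restrict_restrict Int_absorb1)
    moreover have "subtopology (subtopology X F) A = subtopology X A"
      using that by (simp add: subtopology_subtopology Int_absorb1)
    ultimately show ?thesis by (simp add: almost_equicontinuous_restrict_functions)
  qed
  then show ?thesis
    unfolding hereditarily_almost_equicontinuous_def closedin_closed_subtopology[OF assms] by auto
qed

lemma hereditarily_almost_equicontinuous_alt: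
  "hereditarily_almost_equicontinuous X d G \<longleftrightarrow>
    (\<forall>A. closedin X A \<and> A \<noteq> {} \<longrightarrow> almost_equicontinuous (subtopology X A) d G)"
  by (simp add: hereditarily_almost_equicontinuous_def almost_equicontinuous_restrict_functions)

text \<open>The scheme is built inside the subspace \<open>A\<close>. One and the same
  \<open>F\<close> refutes almost equicontinuity and the Lindelof property, so a single construction
  serves both conditions on separable compact sets.\<close>

lemma exists_compact_separable_witness:
  assumes X: "Cech_complete_space X" and "Metric_space M d" and G: "G \<subseteq> continuous_functions X M d"
    and cpt: "compactin (pointwise_topology X M d) (pointwise_topology X M d closure_of G)"
    and A: "closedin X A" and nae: "\<not> almost_equicontinuous (subtopology X A) d G"
  obtains F where "compactin X F" "closedin X F" "F \<noteq> {}" "F \<subseteq> A" "separable_space (subtopology X F)"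
    "\<not> almost_equicontinuous (subtopology X F) d G"
    "\<not> Lindelof_space (weak_topology F (Metric_space.mtopology M d)
          (restrict_functions (pointwise_topology X M d closure_of G) F))"
proof -
  interpret Metric_space M d by fact
  let ?H = "pointwise_topology X M d closure_of G"
  let ?Y = "subtopology X A"
  have P: "pointwise_topology X M d = product_topology (\<lambda>_. mtopology) (topspace X)"
    by (simp add: pointwise_topology_def)
  have cont: "continuous_map X mtopology k" and ext: "k \<in> extensional (topspace X)" if "k \<in> G" for k
    using that G by (auto simp: continuous_functions_def)
  have maps: "k x \<in> M" if "k \<in> G" "x \<in> topspace X" for k x
    using continuous_map_image_subset_topspace[OF cont[OF that(1)]] that(2) by auto
  have "G \<subseteq> topspace (pointwise_topology X M d)"
    using maps ext by (auto simp: P PiE_iff extensional_def)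
  then have GH: "G \<subseteq> ?H" by (rule closure_of_subset)
  \<comment> \<open>Evaluation at \<open>x\<close> is continuous, so the values of \<open>G\<close>
    at \<open>x\<close> lie in a compact set.\<close>
  have tb: "mtotally_bounded ((\<lambda>k. k x) ` G)" if "x \<in> topspace X" for x
  proof -
    have "continuous_map (pointwise_topology X M d) mtopology (\<lambda>k. k x)"
      unfolding P using that by (rule continuous_map_product_projection)
    then have "compactin mtopology ((\<lambda>k. k x) ` ?H)"
      using cpt by (rule image_compactin[rotated])
    then have "mtotally_bounded ((\<lambda>k. k x) ` ?H)" by (rule compactin_imp_mtotally_bounded)
    then show ?thesis by (rule mtotally_bounded_subset) (use GH in blast)
  qed
  obtain \<U> where "cover_complete X \<U>" using Cech_complete_cover_complete[OF X] by blast
  then have comp: "cover_complete ?Y (\<lambda>n. (\<inter>) A ` \<U> n)" using A by (rule cover_complete_subtopology)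
  have reg: "regular_space ?Y"
    using X by (simp add: Cech_complete_space_def completely_regular_imp_regular_space regular_space_subtopology)
  have contY: "continuous_map ?Y mtopology k" if "k \<in> G" for k
    using cont[OF that] by (rule continuous_map_from_subtopology)
  have tbY: "mtotally_bounded ((\<lambda>k. k x) ` G)" if "x \<in> topspace ?Y" for x
    using tb that by simp
  obtain \<epsilon> C g h where "separating_scheme M d ?Y (\<lambda>n. (\<inter>) A ` \<U> n) G \<epsilon> C g h"
    using exists_separating_scheme[OF reg comp contY tbY nae] by blast
  then interpret S: separating_scheme M d ?Y "\<lambda>n. (\<inter>) A ` \<U> n" G \<epsilon> C g h .
  have coreX: "S.core \<subseteq> topspace X"
    using compactin_subset_topspace[OF S.compactin_core] by auto
  show thesis
  proof (rule S.exists_minimal)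
    fix F
    assume F: "closedin ?Y F" "F \<subseteq> S.core" "compactin ?Y F" and meets: "\<And>s. F \<inter> C s \<noteq> {}"
      and minimal: "\<And>V. \<lbrakk>openin ?Y V; V \<inter> F \<noteq> {}\<rbrakk> \<Longrightarrow> \<exists>s. F \<inter> C s \<subseteq> V"
    have FY: "F \<subseteq> topspace ?Y" using F(1) by (rule closedin_subset)
    then have FA: "F \<subseteq> A" by auto
    then have sub: "subtopology ?Y F = subtopology X F"
      by (simp add: subtopology_subtopology Int_absorb1)
    have F0: "F \<noteq> {}" using meets[of "[]"] by blast
    show thesis
    proof (rule that)
      show "compactin X F" using F(3) by (simp add: compactin_subtopology)
      show "closedin X F" using F(1) A by (rule closedin_trans_full)
      show "F \<noteq> {}" "F \<subseteq> A" by fact+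
      show "separable_space (subtopology X F)"
        using S.separable_minimal[OF FY meets minimal] sub by simp
      show "\<not> almost_equicontinuous (subtopology X F) d G"
        using S.not_almost_equicontinuous_minimal[OF F0 FY meets minimal] maps sub by simp
      show "\<not> Lindelof_space (weak_topology F mtopology (restrict_functions ?H F))"
        using S.not_Lindelof_weak_topology[OF cpt[unfolded P] _ coreX F(1,2) meets] GH[unfolded P] P by simp
    qed
  qed
qed

theorem corollary1p4:
  fixes X :: "'a topology"
    and M :: "'b set"
    and d :: "'b \<Rightarrow> 'b \<Rightarrow> real"
    and G :: "('a \<Rightarrow> 'b) set"
  assumes "Cech_complete_space X"
    and "Metric_space M d"
    and "G \<subseteq> continuous_functions X M d"
    and "compactin (pointwise_topology X M d) (pointwise_topology X M d closure_of G)"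
  shows
    "(hereditarily_almost_equicontinuous X d G \<longleftrightarrow>
       (\<forall>F. compactin X F \<and> separable_space (subtopology X F) \<longrightarrow>
          hereditarily_almost_equicontinuous (subtopology X F) d (restrict_functions G F))) \<and>
     ((\<forall>F. compactin X F \<and> separable_space (subtopology X F) \<longrightarrow>
          Lindelof_space
            (weak_topology F (Metric_space.mtopology M d)
              (restrict_functions (pointwise_topology X M d closure_of G) F))) \<longrightarrow>
      (\<forall>F. compactin X F \<and> separable_space (subtopology X F) \<longrightarrow>
          hereditarily_almost_equicontinuous (subtopology X F) d (restrict_functions G F)))"
    (is "(?a \<longleftrightarrow> ?b) \<and> (?c \<longrightarrow> ?b)")
proof -
  have closed: "closedin X F" if "compactin X F" for F
    using that assms(1) by (simp add: Cech_complete_space_def compactin_imp_closedin)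
  have ab: ?b if ?a
    using that
    by (auto simp: hereditarily_almost_equicontinuous_alt[of X] hereditarily_almost_equicontinuous_subtopology[OF closed])
  \<comment> \<open>A failure of \<open>?a\<close> produces a witness at which both
    \<open>?b\<close> and \<open>?c\<close> fail; thus \<open>?c\<close> implies \<open>?b\<close>
    by way of \<open>?a\<close>.\<close>
  have a: ?a if "?b \<or> ?c"
    unfolding hereditarily_almost_equicontinuous_alt
  proof (intro allI impI, rule ccontr)
    fix A assume A: "closedin X A \<and> A \<noteq> {}" and "\<not> almost_equicontinuous (subtopology X A) d G"
    then obtain F where F: "compactin X F" "closedin X F" "F \<noteq> {}" "separable_space (subtopology X F)"
      "\<not> almost_equicontinuous (subtopology X F) d G"
      "\<not> Lindelof_space (weak_topology F (Metric_space.mtopology M d)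
          (restrict_functions (pointwise_topology X M d closure_of G) F))"
      by (metis exists_compact_separable_witness[OF assms])
    then have "\<not> hereditarily_almost_equicontinuous (subtopology X F) d (restrict_functions G F)"
      by (auto simp: hereditarily_almost_equicontinuous_subtopology[OF F(2)])
    with F that show False by blast
  qed
  show ?thesis using a ab by blast
qed

end
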